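(* Let $\Gamma$ be the $3$-regular tree, $\Gamma_0$ its edge graph with graph distance $d$, and let $\lambda$ be in the interior of $\Sigma=[3-2\sqrt2,3+2\sqrt2]$, $\lambda=3-2\sqrt2\cos(t\log2)$ with $0<t<\frac\pi{\log2}$. Let $$b(\lambda)=8\,\frac{-\lambda^2+6\lambda}{-\lambda^2+6\lambda-1},\qquad \tilde P_\lambda F(x)=\frac1{3(6-\lambda)}\sum_{y\in\Gamma_0}\psi_{\frac12+it}(d(x,y))F(y).$$ Suppose $F:\Gamma_0\to\mathbb C$ has finite support. Then $$\langle\tilde P_\lambda F,F\rangle=36\,b(\lambda)^{-1}\langle\tilde P_\lambda F,\tilde P_\lambda F\rangle_M,$$ where $\langle F,G\rangle_M=\lim_{N\to\infty}\frac1N\sum_{x\in\Gamma_0,\ d(x,x_0)\le N}F(x)\overline{G(x)}$ (for the functions in question the limit exists and is independent of $x_0\in\Gamma_0$).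
   Context: The edge graph $\Gamma_0$ has the edges of $\Gamma$ as vertices, two being adjacent iff they share an endpoint. $\langle F,G\rangle=\sum_{x\in\Gamma_0}F(x)\overline{G(x)}$. For $z\in\mathbb C$ with $2^{2z-1}\neq1$: $c(z)=\frac13\,\frac{2^{1-z}-2^{z-1}}{2^{-z}-2^{z-1}}$, $\varphi_z(n)=c(z)2^{-nz}+c(1-z)2^{-n(1-z)}$ for $n\in\mathbb Z$, and $\psi_z(n)=2\varphi_z(n)+\varphi_z(n+1)+\varphi_z(n-1)$. *)

theory Defs
  imports "HOL-Analysis.Analysis"
begin

text \<open>
  A simple graph is a vertex set \<open>V\<close> together with a set \<open>E\<close> of two-element subsets of \<open>V\<close>.
  Walks, connectedness and distance are stated for a vertex set \<open>X\<close> with an adjacency relation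
  \<open>R\<close>, so that they serve both a graph and its edge graph.
\<close>

definition simple_graph :: "'v set \<Rightarrow> 'v set set \<Rightarrow> bool" where
  "simple_graph V E \<longleftrightarrow> (\<forall>e\<in>E. e \<subseteq> V \<and> card e = 2)"

definition adjacent :: "'v set set \<Rightarrow> 'v \<Rightarrow> 'v \<Rightarrow> bool" where
  "adjacent E u v \<longleftrightarrow> u \<noteq> v \<and> {u, v} \<in> E"

definition walk :: "'a set \<Rightarrow> ('a \<Rightarrow> 'a \<Rightarrow> bool) \<Rightarrow> 'a list \<Rightarrow> bool" where
  "walk X R xs \<longleftrightarrow> xs \<noteq> [] \<and> set xs \<subseteq> X \<and> successively R xs"

definition connected_graph :: "'a set \<Rightarrow> ('a \<Rightarrow> 'a \<Rightarrow> bool) \<Rightarrow> bool" where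
  "connected_graph X R \<longleftrightarrow> (\<forall>x\<in>X. \<forall>y\<in>X. \<exists>xs. walk X R xs \<and> hd xs = x \<and> last xs = y)"

definition is_cycle :: "'a set \<Rightarrow> ('a \<Rightarrow> 'a \<Rightarrow> bool) \<Rightarrow> 'a list \<Rightarrow> bool" where
  "is_cycle X R xs \<longleftrightarrow> walk X R xs \<and> distinct xs \<and> length xs \<ge> 3 \<and> R (last xs) (hd xs)"

definition tree :: "'v set \<Rightarrow> 'v set set \<Rightarrow> bool" where
  "tree V E \<longleftrightarrow> V \<noteq> {} \<and> simple_graph V E \<and> connected_graph V (adjacent E)
     \<and> (\<nexists>xs. is_cycle V (adjacent E) xs)"

definition regular :: "nat \<Rightarrow> 'v set \<Rightarrow> 'v set set \<Rightarrow> bool" where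
  "regular k V E \<longleftrightarrow> (\<forall>v\<in>V. card {w \<in> V. adjacent E v w} = k)"

text \<open>The minimal length of a walk; the value is arbitrary if there is none.\<close>

definition graph_dist :: "'a set \<Rightarrow> ('a \<Rightarrow> 'a \<Rightarrow> bool) \<Rightarrow> 'a \<Rightarrow> 'a \<Rightarrow> nat" where
  "graph_dist X R x y =
     (LEAST n. \<exists>xs. walk X R xs \<and> hd xs = x \<and> last xs = y \<and> length xs = Suc n)"

text \<open>The edge graph of \<open>(V, E)\<close> has vertex set \<open>E\<close> and the following adjacency relation.\<close>

definition edge_adjacent :: "'v set \<Rightarrow> 'v set \<Rightarrow> bool" where
  "edge_adjacent e f \<longleftrightarrow> e \<noteq> f \<and> e \<inter> f \<noteq> {}"

definition edge_dist :: "'v set set \<Rightarrow> 'v set \<Rightarrow> 'v set \<Rightarrow> nat" where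
  "edge_dist E = graph_dist E edge_adjacent"

text \<open>
  Functions on the edge graph are represented by total functions on \<open>'v set\<close>, of which only the
  values on \<open>E\<close> matter.
\<close>

definition edge_inner :: "'v set set \<Rightarrow> ('v set \<Rightarrow> complex) \<Rightarrow> ('v set \<Rightarrow> complex) \<Rightarrow> complex" where
  "edge_inner E F G = (\<Sum>\<^sub>\<infinity>x\<in>E. F x * cnj (G x))"

text \<open>Balls in the edge graph of a 3-regular tree are finite, so this is a genuine finite sum.\<close>

definition ball_average ::
  "'v set set \<Rightarrow> 'v set \<Rightarrow> ('v set \<Rightarrow> complex) \<Rightarrow> ('v set \<Rightarrow> complex) \<Rightarrow> nat \<Rightarrow> complex" where
  "ball_average E x0 F G N =
     1 / of_nat N * (\<Sum>x\<in>{x\<in>E. edge_dist E x x0 \<le> N}. F x * cnj (G x))"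

text \<open>
  The pairing \<open>\<langle>F, G\<rangle>\<^sub>M\<close>, with its base point \<open>x0\<close> kept explicit; the value is
  meaningful only if the limit exists.
\<close>

definition mean_inner ::
  "'v set set \<Rightarrow> 'v set \<Rightarrow> ('v set \<Rightarrow> complex) \<Rightarrow> ('v set \<Rightarrow> complex) \<Rightarrow> complex" where
  "mean_inner E x0 F G = lim (ball_average E x0 F G)"

text \<open>Intended for \<open>2 powr (2 * z - 1) \<noteq> 1\<close>, where the denominator does not vanish.\<close>

definition c_fun :: "complex \<Rightarrow> complex" where
  "c_fun z = 1/3 * ((2 powr (1 - z) - 2 powr (z - 1)) / (2 powr (- z) - 2 powr (z - 1)))"

definition phi :: "complex \<Rightarrow> int \<Rightarrow> complex" where
  "phi z n = c_fun z * 2 powr (- of_int n * z) + c_fun (1 - z) * 2 powr (- of_int n * (1 - z))"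

definition psi :: "complex \<Rightarrow> int \<Rightarrow> complex" where
  "psi z n = 2 * phi z n + phi z (n + 1) + phi z (n - 1)"

definition b_fun :: "real \<Rightarrow> real" where
  "b_fun lam = 8 * ((- lam\<^sup>2 + 6 * lam) / (- lam\<^sup>2 + 6 * lam - 1))"

text \<open>
  The operator \<open>P\<^sub>\<lambda>\<close> (with tilde); the arguments are to be related by
  \<open>lam = 3 - 2 * sqrt 2 * cos (t * ln 2)\<close>.
\<close>

definition P_tilde ::
  "'v set set \<Rightarrow> real \<Rightarrow> real \<Rightarrow> ('v set \<Rightarrow> complex) \<Rightarrow> 'v set \<Rightarrow> complex" where
  "P_tilde E lam t F x = 1 / of_real (3 * (6 - lam)) *
     (\<Sum>\<^sub>\<infinity>y\<in>E. psi (1/2 + \<i> * of_real t) (int (edge_dist E x y)) * F y)"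

end

theory Submission
  imports Defs
begin

text \<open>
  Write \<open>\<kappa>(n)\<close> for the kernel \<open>\<psi>(n) / (3 (6 - \<lambda>))\<close> of the operator, so that \<open>P F\<close> is
  the finite sum of the functions \<open>F y \<cdot> \<kappa>(d(-, y))\<close>. Both sides of the identity are
  sesquilinear in \<open>F\<close>, and \<open>\<kappa>\<close> is real, so everything reduces to two point masses: the mean of
  the product \<open>\<kappa>(d(-, y)) \<kappa>(d(-, y'))\<close> has to be \<open>b(\<lambda>) / 36\<close> times \<open>\<kappa>(d(y', y))\<close>.

  The reason is a mean value property. As seen from an edge \<open>y\<close>, an edge at distance
  \<open>n \<ge> 1\<close> has one neighbour at distance \<open>n - 1\<close>, one at distance \<open>n\<close> and two at distance
  \<open>n + 1\<close>, while \<open>y\<close> itself has four neighbours (\<open>sum_neighbours_radial\<close>). Because of these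
  numbers, \<open>\<kappa>(d(-, y))\<close> is an eigenfunction of the adjacency operator for every \<open>y\<close>, and the
  sum of any eigenfunction \<open>g\<close> over the sphere of radius \<open>n\<close> about \<open>y'\<close> is
  \<open>g(y') \<kappa>(n) / \<kappa>(0)\<close> times the size of the sphere: both quantities obey the same
  three-term recurrence in \<open>n\<close> (\<open>sum_edge_sphere_eigenfunction\<close>). Applied to
  \<open>g = \<kappa>(d(-, y))\<close>, this turns the sum of the product over a ball about \<open>y'\<close> into
  \<open>\<kappa>(d(y', y)) / \<kappa>(0)\<close> times the sum of \<open>2^(n+1) \<kappa>(n)^2\<close> over the radii, up to
  the term for radius 0. Moving the centre of the ball to another base point costs a bounded
  amount, since the product decays like \<open>2^(-n)\<close> and the spheres grow like \<open>2^n\<close> (\<open>ball_sum_base_point\<close>).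

  What remains is one constant. With \<open>q = 2^(-z)\<close> and \<open>r = 2^(z-1)\<close>, where \<open>z = 1/2 + i t\<close>, one has
  \<open>\<kappa>(n) = a q^n + b r^n\<close> and \<open>q r = 1/2\<close>, so \<open>2^(n+1) \<kappa>(n)^2\<close> is \<open>4 a b\<close> plus two
  oscillating terms of mean zero (\<open>sphere_weighted_mean\<close>). Hence the constant is
  \<open>4 a b / \<kappa>(0)\<close>, and \<open>a + b = 2/9\<close> together with \<open>648 a b = b(\<lambda>)\<close> identifies it as
  \<open>b(\<lambda>) / 36\<close> (\<open>spectral_kernel\<close>).

  The local count comes from the geometry of the tree. Let the height of a vertex be its distance
  to the edge \<open>y\<close>. Two different neighbours of a vertex \<open>v\<close>, neither of them higher than \<open>v\<close>, would
  start two descents that join up to a walk without backtracking that visits a vertex twice,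
  which a tree does not allow. So every vertex has one parent and two children, and the distance
  of an edge to \<open>y\<close> is the height of its upper endpoint.
\<close>

section \<open>Walks in acyclic graphs\<close>

fun nonbacktracking :: "'a list \<Rightarrow> bool" where
  "nonbacktracking (a # b # c # xs) \<longleftrightarrow> a \<noteq> c \<and> nonbacktracking (b # c # xs)"
| "nonbacktracking _ \<longleftrightarrow> True"

lemma nonbacktracking_tl: "nonbacktracking (x # xs) \<Longrightarrow> nonbacktracking xs"
  by (cases xs rule: nonbacktracking.cases) auto

lemma nonbacktracking_Cons:
  assumes "nonbacktracking xs" "x \<notin> set (tl xs)"
  shows "nonbacktracking (x # xs)"
  using assms by (cases xs rule: nonbacktracking.cases) auto

lemma nonbacktracking_append:
  assumes "nonbacktracking (as @ [u, v])" "nonbacktracking (u # v # bs)"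
  shows "nonbacktracking (as @ u # v # bs)"
  using assms
proof (induction as)
  case (Cons a as)
  have "nonbacktracking (as @ u # v # bs)"
    using Cons by (simp add: nonbacktracking_tl)
  then show ?case
    using Cons.prems(1) by (cases as; cases "tl as") auto
qed simp

lemma nonbacktracking_rev: "nonbacktracking xs \<Longrightarrow> nonbacktracking (rev xs)"
proof (induction xs rule: nonbacktracking.induct)
  case (1 a b c xs)
  then show ?case
    using nonbacktracking_append[of "rev xs" c b "[a]"] by auto
qed simp_all

text \<open>
  Peel off the first vertex \<open>x\<close>. If it came back, the walk up to its first return would be a
  cycle: the part after \<open>x\<close> is distinct by induction, and absence of loops and of backtracking
  makes the return take at least three steps.
\<close>

lemma nonbacktracking_walk_distinct:
  assumes "walk X R xs" "nonbacktracking xs" "\<nexists>zs. is_cycle X R zs" "\<And>x. \<not> R x x"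
  shows "distinct xs"
  using assms(1,2)
proof (induction xs)
  case (Cons x ys)
  show ?case
  proof (cases "ys = []")
    case False
    then have "distinct ys"
      using Cons nonbacktracking_tl by (fastforce simp: walk_def successively_Cons)
    moreover have "x \<notin> set ys"
    proof
      assume "x \<in> set ys"
      then obtain as bs where ys: "ys = as @ x # bs" "x \<notin> set as"
        by (meson split_list_first)
      have w: "successively R (x # as @ x # bs)" "set (x # as) \<subseteq> X"
        using Cons.prems(1) ys by (auto simp: walk_def)
      have "as \<noteq> []"
        using w assms(4) by auto
      moreover have "tl as \<noteq> []"
        using w Cons.prems(2) ys \<open>as \<noteq> []\<close> by (cases as) auto
      ultimately have "length (x # as) \<ge> 3"
        by (cases as; cases "tl as") auto
      moreover have "R (last (x # as)) x" "successively R (x # as)"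
        using w \<open>as \<noteq> []\<close> by (auto simp: successively_Cons successively_append_iff)
      moreover have "distinct (x # as)"
        using ys \<open>distinct ys\<close> by auto
      ultimately have "is_cycle X R (x # as)"
        using w by (simp add: is_cycle_def walk_def)
      then show False
        using assms(3) by blast
    qed
    ultimately show ?thesis by simp
  qed simp
qed simp

section \<open>Distances\<close>

lemma walk_lipschitz:
  fixes f :: "'a \<Rightarrow> nat"
  assumes "walk X R xs" "\<And>a b. a \<in> X \<Longrightarrow> b \<in> X \<Longrightarrow> R a b \<Longrightarrow> f a \<le> Suc (f b)"
  shows "Suc (f (hd xs)) \<le> f (last xs) + length xs"
  using assms(1)
proof (induction xs)
  case (Cons x ys)
  show ?case
  proof (cases "ys = []")
    case False
    then have "walk X R ys" "R x (hd ys)" "x \<in> X" "hd ys \<in> X"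
      using Cons.prems by (auto simp: walk_def successively_Cons)
    then show ?thesis
      using Cons.IH assms(2)[of x "hd ys"] False by fastforce
  qed simp
qed (simp add: walk_def)

lemma walk_of_descent:
  fixes f :: "'a \<Rightarrow> nat"
  assumes "\<And>a. a \<in> X \<Longrightarrow> f a = 0 \<Longrightarrow> a = y"
    and "\<And>a n. a \<in> X \<Longrightarrow> f a = Suc n \<Longrightarrow> \<exists>b\<in>X. R a b \<and> f b = n"
    and "x \<in> X"
  shows "\<exists>xs. walk X R xs \<and> hd xs = x \<and> last xs = y \<and> length xs = Suc (f x)"
  using assms(3)
proof (induction "f x" arbitrary: x)
  case 0
  then show ?case
    using assms(1)[of x] by (intro exI[of _ "[x]"]) (auto simp: walk_def)
next
  case (Suc n)
  obtain b where b: "b \<in> X" "R x b" "f b = n"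
    using assms(2) Suc.hyps(2) Suc.prems by metis
  then obtain xs where "walk X R xs" "hd xs = b" "last xs = y" "length xs = Suc n"
    using Suc.hyps(1)[of b] by auto
  then show ?case
    using b Suc by (intro exI[of _ "x # xs"]) (auto simp: walk_def successively_Cons)
qed

text \<open>
  A function is the distance to \<open>y\<close> as soon as it is 1-Lipschitz along edges, which bounds every
  walk from below, and can be decreased step by step down to its only zero \<open>y\<close>, which provides a
  walk of that length.
\<close>

lemma graph_dist_eqI:
  fixes f :: "'a \<Rightarrow> nat"
  assumes "\<And>a. a \<in> X \<Longrightarrow> f a = 0 \<longleftrightarrow> a = y"
    and "\<And>a n. a \<in> X \<Longrightarrow> f a = Suc n \<Longrightarrow> \<exists>b\<in>X. R a b \<and> f b = n"
    and "\<And>a b. a \<in> X \<Longrightarrow> b \<in> X \<Longrightarrow> R a b \<Longrightarrow> f a \<le> Suc (f b)"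
    and "x \<in> X" "y \<in> X"
  shows "graph_dist X R x y = f x"
  unfolding graph_dist_def
proof (rule Least_equality)
  show "\<exists>xs. walk X R xs \<and> hd xs = x \<and> last xs = y \<and> length xs = Suc (f x)"
    using walk_of_descent[of X f y R x] assms by blast
  fix n
  assume "\<exists>xs. walk X R xs \<and> hd xs = x \<and> last xs = y \<and> length xs = Suc n"
  then show "f x \<le> n"
    using walk_lipschitz[of X R _ f] assms(1)[of y] assms(3,5) by fastforce
qed

definition dist_to :: "'a set \<Rightarrow> ('a \<Rightarrow> 'a \<Rightarrow> bool) \<Rightarrow> 'a set \<Rightarrow> 'a \<Rightarrow> nat" where
  "dist_to X R Y v = (LEAST n. \<exists>xs. walk X R xs \<and> hd xs = v \<and> last xs \<in> Y \<and> length xs = Suc n)"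

lemma dist_to_le:
  assumes "walk X R xs" "last xs \<in> Y"
  shows "dist_to X R Y (hd xs) \<le> length xs - 1"
  unfolding dist_to_def using assms by (intro Least_le exI[of _ xs]) (auto simp: walk_def)

lemma dist_to_walk:
  assumes "connected_graph X R" "v \<in> X" "Y \<subseteq> X" "Y \<noteq> {}"
  obtains xs where "walk X R xs" "hd xs = v" "last xs \<in> Y" "length xs = Suc (dist_to X R Y v)"
proof -
  obtain a xs where "a \<in> Y" "walk X R xs" "hd xs = v" "last xs = a"
    using assms by (metis connected_graph_def ex_in_conv subsetD)
  then have "\<exists>n xs. walk X R xs \<and> hd xs = v \<and> last xs \<in> Y \<and> length xs = Suc n"
    by (intro exI[of _ "length xs - 1"] exI[of _ xs]) (auto simp: walk_def)
  from LeastI_ex[OF this] show thesis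
    using that unfolding dist_to_def by blast
qed

lemma dist_to_eq_0_iff:
  assumes "connected_graph X R" "v \<in> X" "Y \<subseteq> X" "Y \<noteq> {}"
  shows "dist_to X R Y v = 0 \<longleftrightarrow> v \<in> Y"
proof
  assume "dist_to X R Y v = 0"
  then obtain xs where "hd xs = v" "last xs \<in> Y" "length xs = Suc 0"
    using dist_to_walk[OF assms] by metis
  then show "v \<in> Y"
    by (cases xs) auto
next
  assume "v \<in> Y"
  then show "dist_to X R Y v = 0"
    using dist_to_le[of X R "[v]" Y] assms by (auto simp: walk_def)
qed

lemma dist_to_lipschitz:
  assumes "connected_graph X R" "v \<in> X" "w \<in> X" "R v w" "Y \<subseteq> X" "Y \<noteq> {}"
  shows "dist_to X R Y v \<le> Suc (dist_to X R Y w)"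
proof -
  obtain xs where xs: "walk X R xs" "hd xs = w" "last xs \<in> Y" "length xs = Suc (dist_to X R Y w)"
    using dist_to_walk[of X R w Y] assms by metis
  then have "walk X R (v # xs)" "last (v # xs) \<in> Y"
    using assms by (auto simp: walk_def successively_Cons)
  from dist_to_le[OF this] show ?thesis
    using xs by simp
qed

lemma dist_to_descent:
  assumes "connected_graph X R" "v \<in> X" "Y \<subseteq> X" "Y \<noteq> {}" "dist_to X R Y v = Suc n"
  obtains w where "w \<in> X" "R v w" "dist_to X R Y w = n"
proof -
  obtain xs where "walk X R xs" "hd xs = v" "last xs \<in> Y" "length xs = Suc (Suc n)"
    using dist_to_walk[of X R v Y] assms by metis
  then obtain w ws where xs: "walk X R (v # w # ws)" "last (w # ws) \<in> Y" "length ws = n"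
    by (auto simp: length_Suc_conv)
  then have w: "walk X R (w # ws)" "w \<in> X" "R v w"
    by (auto simp: walk_def)
  have "dist_to X R Y w = n"
    using dist_to_le[OF w(1) xs(2)] xs(3) dist_to_lipschitz[of X R v w Y] assms w by simp
  then show thesis
    using that w by blast
qed

section \<open>Heights above an edge of the cubic tree\<close>

locale cubic_tree =
  fixes V :: "'v set" and E :: "'v set set"
  assumes tree: "tree V E" and cubic: "regular 3 V E"
begin

definition neighbours :: "'v set \<Rightarrow> 'v set set" where
  "neighbours x = {x'\<in>E. edge_adjacent x x'}"

definition height :: "'v set \<Rightarrow> 'v \<Rightarrow> nat" where
  "height y = dist_to V (adjacent E) y"

lemma connected: "connected_graph V (adjacent E)"
  and acyclic: "\<nexists>xs. is_cycle V (adjacent E) xs"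
  using tree by (auto simp: tree_def)

lemma adjacent_in_V: "adjacent E v w \<Longrightarrow> v \<in> V \<and> w \<in> V"
  using tree by (auto simp: tree_def simple_graph_def adjacent_def)

lemma adjacent_sym: "adjacent E v w \<longleftrightarrow> adjacent E w v"
  by (auto simp: adjacent_def insert_commute)

lemma edgeE:
  assumes "x \<in> E"
  obtains v w where "x = {v, w}" "v \<noteq> w" "v \<in> V" "w \<in> V" "adjacent E v w"
proof -
  have "card x = 2" "x \<subseteq> V"
    using assms tree by (auto simp: tree_def simple_graph_def)
  then obtain v w where "x = {v, w}" "v \<noteq> w"
    by (meson card_2_iff)
  then show thesis
    using that assms \<open>x \<subseteq> V\<close> by (auto simp: adjacent_def)
qed

lemma edge_subset: "x \<in> E \<Longrightarrow> x \<subseteq> V" and edge_nonempty: "x \<in> E \<Longrightarrow> x \<noteq> {}"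
  by (auto elim!: edgeE)

lemma finite_edge:
  assumes "x \<in> E"
  shows "finite x"
proof -
  obtain v w where "x = {v, w}"
    using edgeE[OF assms] by metis
  then show ?thesis
    by simp
qed

lemma edge_eqI: "x \<in> E \<Longrightarrow> y \<in> E \<Longrightarrow> x \<subseteq> y \<Longrightarrow> x = y"
  by (elim edgeE) auto

context
  fixes y assumes y: "y \<in> E"
begin

lemma height_eq_0_iff: "v \<in> V \<Longrightarrow> height y v = 0 \<longleftrightarrow> v \<in> y"
  unfolding height_def using y edge_subset edge_nonempty connected
  by (intro dist_to_eq_0_iff) auto

lemma height_lipschitz: "adjacent E v w \<Longrightarrow> height y v \<le> Suc (height y w)"
  unfolding height_def using y edge_subset edge_nonempty connected adjacent_in_V
  by (intro dist_to_lipschitz) auto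

text \<open>
  For a vertex \<open>v\<close> on \<open>y\<close> the truncated difference makes \<open>p\<close> the other endpoint of \<open>y\<close>, so that
  all vertices can be treated alike.
\<close>

lemma height_descent:
  assumes "v \<in> V"
  obtains p where "adjacent E v p" "height y p = height y v - 1"
proof (cases "height y v")
  case 0
  then obtain p where "y = {v, p}" "v \<noteq> p"
    using y assms height_eq_0_iff edgeE by (metis doubleton_eq_iff insertE singletonD)
  moreover from this have "adjacent E v p"
    using y by (simp add: adjacent_def)
  ultimately show thesis
    using that[of p] 0 height_eq_0_iff[of p] adjacent_in_V by auto
next
  case (Suc n)
  then obtain p where "adjacent E v p" "height y p = n"
    unfolding height_def
    using dist_to_descent[OF connected assms edge_subset[OF y] edge_nonempty[OF y]] by metis
  then show thesis
    using that Suc by simp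
qed

text \<open>
  A descent reaches \<open>y\<close> at either of its endpoints; if it is the wrong one, the edge \<open>y\<close> itself is
  added. In this way all descents can be made to end in the same vertex \<open>a\<close>, which is what
  produces the repeated vertex in the uniqueness of parents below.
\<close>

lemma path_to_endpoint:
  assumes "a \<in> y" "v \<in> V"
  shows "\<exists>xs. walk V (adjacent E) (v # xs) \<and> last (v # xs) = a \<and> nonbacktracking (v # xs)
    \<and> (\<forall>c\<in>set xs. height y c \<le> height y v - 1)"
  using assms(2)
proof (induction "height y v" arbitrary: v)
  case 0
  then have "v \<in> y"
    using height_eq_0_iff by simp
  show ?case
  proof (cases "v = a")
    case True
    then show ?thesis
      using 0 by (intro exI[of _ "[]"]) (auto simp: walk_def)
  next
    case False
    obtain c d where "y = {c, d}" "adjacent E c d"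
      using edgeE[OF y] by metis
    then have "adjacent E v a" "a \<in> V"
      using False \<open>v \<in> y\<close> assms adjacent_sym adjacent_in_V by auto
    moreover have "height y a = 0"
      using \<open>a \<in> V\<close> assms height_eq_0_iff by simp
    ultimately show ?thesis
      using 0 by (intro exI[of _ "[a]"]) (auto simp: walk_def)
  qed
next
  case (Suc n)
  obtain p where p: "adjacent E v p" "height y p = n"
    using height_descent[OF Suc.prems] Suc.hyps(2) by (metis diff_Suc_1)
  then obtain xs where xs: "walk V (adjacent E) (p # xs)" "last (p # xs) = a"
    "nonbacktracking (p # xs)" "\<forall>c\<in>set xs. height y c \<le> n - 1"
    using Suc.hyps(1)[of p] adjacent_in_V by auto
  have "v \<notin> set xs"
    using xs(4) Suc.hyps(2) by fastforce
  then show ?case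
    using xs p Suc.prems Suc.hyps(2)
    by (intro exI[of _ "p # xs"]) (auto simp: walk_def intro!: nonbacktracking_Cons)
qed

text \<open>
  The reversed path from \<open>u\<close>, then \<open>v\<close>, then the path from \<open>p\<close> form a walk that starts and ends in
  \<open>a\<close>. It has no backtracking: not at \<open>v\<close> because \<open>u \<noteq> p\<close>, and not next to it because both paths
  stay strictly below the height of \<open>v\<close> after their first vertex.
\<close>

lemma unique_parent:
  assumes "adjacent E v p" "height y p \<le> height y v" "adjacent E v u" "height y u \<le> height y v"
  shows "u = p"
proof (cases "height y v = 0")
  case True
  then have "height y u = 0" "height y p = 0"
    using assms by auto
  then have "u \<in> y" "p \<in> y" "v \<in> y"
    using True assms(1,3) height_eq_0_iff adjacent_in_V by metis+
  moreover have "u \<noteq> v" "p \<noteq> v"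
    using assms by (auto simp: adjacent_def)
  moreover obtain c d where "y = {c, d}"
    using edgeE[OF y] by metis
  ultimately show ?thesis
    by auto
next
  case False
  show ?thesis
  proof (rule ccontr)
    assume "u \<noteq> p"
    obtain a where a: "a \<in> y"
      using edge_nonempty[OF y] by blast
    have V: "u \<in> V" "v \<in> V" "p \<in> V"
      using assms adjacent_in_V by auto
    obtain us where us: "walk V (adjacent E) (u # us)" "last (u # us) = a"
      "nonbacktracking (u # us)" "\<forall>c\<in>set us. height y c \<le> height y u - 1"
      using path_to_endpoint[OF a V(1)] by auto
    obtain ps where ps: "walk V (adjacent E) (p # ps)" "last (p # ps) = a"
      "nonbacktracking (p # ps)" "\<forall>c\<in>set ps. height y c \<le> height y p - 1"
      using path_to_endpoint[OF a V(3)] by auto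
    have "v \<notin> set us" "v \<notin> set ps"
      using us(4) ps(4) assms False by fastforce+
    have "nonbacktracking (v # u # us)" "nonbacktracking (v # p # ps)"
      using us(3) ps(3) \<open>v \<notin> set us\<close> \<open>v \<notin> set ps\<close> by (auto intro!: nonbacktracking_Cons)
    from nonbacktracking_rev[OF this(1)] this(2)
    have "nonbacktracking (rev us @ u # v # p # ps)"
      using \<open>u \<noteq> p\<close> by (subst nonbacktracking_append) auto
    moreover have "walk V (adjacent E) (rev us @ u # v # p # ps)"
    proof -
      have "successively (adjacent E) (rev (u # us))"
        unfolding successively_rev using us(1) adjacent_sym
        by (auto simp: walk_def elim!: successively_mono)
      then show ?thesis
        using us(1) ps(1) assms V adjacent_sym
        by (auto simp: walk_def successively_append_iff successively_Cons)
    qed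
    ultimately have "distinct (rev us @ u # v # p # ps)"
      using nonbacktracking_walk_distinct acyclic by (metis adjacent_def)
    moreover have "a \<in> set (u # us)" "a \<in> set (p # ps)"
      using us(2) ps(2) last_in_set[of "u # us"] last_in_set[of "p # ps"] by simp_all
    ultimately show False
      by auto
  qed
qed

lemma parent_children:
  assumes "v \<in> V"
  obtains p a b where "{w\<in>V. adjacent E v w} = {p, a, b}" "p \<noteq> a" "p \<noteq> b" "a \<noteq> b"
    "height y p = height y v - 1" "height y a = Suc (height y v)" "height y b = Suc (height y v)"
proof -
  obtain p where p: "adjacent E v p" "height y p = height y v - 1"
    using height_descent[OF assms] .
  have "card {w\<in>V. adjacent E v w} = 3"
    using cubic assms by (simp add: regular_def)
  moreover have "p \<in> {w\<in>V. adjacent E v w}"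
    using p adjacent_in_V by blast
  ultimately have "card ({w\<in>V. adjacent E v w} - {p}) = 2"
    by simp
  then obtain a b where ab: "{w\<in>V. adjacent E v w} - {p} = {a, b}" "a \<noteq> b"
    by (meson card_2_iff)
  have "height y c = Suc (height y v)" if "c \<in> {a, b}" for c
  proof -
    have "adjacent E v c" "c \<noteq> p"
      using that ab by auto
    then have "\<not> height y c \<le> height y v"
      using unique_parent[OF p(1) _ \<open>adjacent E v c\<close>] p(2) by auto
    then show ?thesis
      using height_lipschitz[of c v] \<open>adjacent E v c\<close> adjacent_sym by fastforce
  qed
  moreover have "{w\<in>V. adjacent E v w} = {p, a, b}" "p \<noteq> a" "p \<noteq> b"
    using ab \<open>p \<in> _\<close> by auto
  ultimately show thesis
    using that[of p a b] p ab by auto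
qed

lemma edge_endpoint_heights:
  assumes "x \<in> E" "x \<noteq> y"
  obtains v w where "x = {v, w}" "adjacent E v w" "height y w = Suc (height y v)"
proof -
  obtain v w where x: "x = {v, w}" "v \<noteq> w" "v \<in> V" "w \<in> V" "adjacent E v w"
    using assms edgeE by metis
  obtain p a b where "{w\<in>V. adjacent E v w} = {p, a, b}"
    "height y p = height y v - 1" "height y a = Suc (height y v)" "height y b = Suc (height y v)"
    using parent_children[OF x(3)] by metis
  moreover have "w \<in> {w\<in>V. adjacent E v w}"
    using x by simp
  ultimately consider "height y w = Suc (height y v)" | "height y w = height y v - 1"
    by auto
  then show thesis
  proof cases
    case 2
    have "height y v \<noteq> 0"
    proof
      assume "height y v = 0"
      with 2 have "height y w = 0"
        by simp
      then have "v \<in> y" "w \<in> y"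
        using \<open>height y v = 0\<close> x(3,4) height_eq_0_iff by blast+
      then show False
        using edge_eqI[OF assms(1) y] assms(2) x by simp
    qed
    then show thesis
      using that[of w v] 2 x adjacent_sym[of v w] by (simp add: insert_commute)
  next
    case 1
    then show thesis
      using that[of v w] x by blast
  qed
qed

lemma max_height_eq_0_iff:
  assumes "x \<in> E"
  shows "Max (height y ` x) = 0 \<longleftrightarrow> x = y"
proof
  show "x = y" if "Max (height y ` x) = 0"
  proof (rule ccontr)
    assume "x \<noteq> y"
    then obtain v w where "x = {v, w}" "height y w = Suc (height y v)"
      using edge_endpoint_heights[OF assms] by metis
    then show False
      using that by simp
  qed
next
  assume "x = y"
  moreover obtain v w where "y = {v, w}" "v \<in> V" "w \<in> V"
    using edgeE[OF y] by metis
  ultimately show "Max (height y ` x) = 0"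
    using height_eq_0_iff by simp
qed

lemma max_height_descent:
  assumes "x \<in> E" "Max (height y ` x) = Suc n"
  shows "\<exists>x'\<in>E. edge_adjacent x x' \<and> Max (height y ` x') = n"
proof -
  have "x \<noteq> y"
    using assms max_height_eq_0_iff by fastforce
  then obtain v w where vw: "x = {v, w}" "adjacent E v w" "height y w = Suc (height y v)"
    using edge_endpoint_heights[OF assms(1)] by metis
  obtain p where p: "adjacent E v p" "height y p = height y v - 1"
    using height_descent adjacent_in_V vw by metis
  have "height y v = n"
    using assms(2) vw by simp
  then have "Max (height y ` {v, p}) = n"
    using p by simp
  moreover have "{v, p} \<in> E" "edge_adjacent x {v, p}"
    using p vw by (auto simp: adjacent_def edge_adjacent_def doubleton_eq_iff)
  ultimately show ?thesis
    by blast
qed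

lemma max_height_lipschitz:
  assumes "x \<in> E" "x' \<in> E" "edge_adjacent x x'"
  shows "Max (height y ` x) \<le> Suc (Max (height y ` x'))"
proof -
  obtain u where u: "u \<in> x" "u \<in> x'"
    using assms(3) by (auto simp: edge_adjacent_def)
  have fin: "finite x" "finite x'"
    using assms finite_edge by blast+
  obtain c d where "x = {c, d}" "adjacent E c d"
    using edgeE[OF assms(1)] by metis
  then have "height y v \<le> Suc (height y u)" if "v \<in> x" for v
    using that u(1) height_lipschitz[of c d] height_lipschitz[of d c] adjacent_sym by auto
  moreover have "height y u \<le> Max (height y ` x')"
    using u fin by simp
  ultimately have "height y v \<le> Suc (Max (height y ` x'))" if "v \<in> x" for v
    using that by fastforce
  then show ?thesis
    using fin u by (subst Max_le_iff) auto
qed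

lemma edge_dist_eq_Max: "x \<in> E \<Longrightarrow> edge_dist E x y = Max (height y ` x)"
  unfolding edge_dist_def
  using max_height_eq_0_iff max_height_descent max_height_lipschitz y by (intro graph_dist_eqI)

lemma edge_dist_eq_0_iff: "x \<in> E \<Longrightarrow> edge_dist E x y = 0 \<longleftrightarrow> x = y"
  by (simp add: edge_dist_eq_Max max_height_eq_0_iff)

lemma edge_dist_descent:
  "x \<in> E \<Longrightarrow> edge_dist E x y = Suc n \<Longrightarrow> \<exists>x'\<in>E. edge_adjacent x x' \<and> edge_dist E x' y = n"
  using max_height_descent by (metis edge_dist_eq_Max)

lemma edge_dist_lipschitz:
  "x \<in> E \<Longrightarrow> x' \<in> E \<Longrightarrow> edge_adjacent x x' \<Longrightarrow> edge_dist E x y \<le> Suc (edge_dist E x' y)"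
  by (simp add: edge_dist_eq_Max max_height_lipschitz)

end

lemma edge_dist_doubleton:
  assumes "y \<in> E" "adjacent E v w"
  shows "edge_dist E {v, w} y = max (height y v) (height y w)"
  using edge_dist_eq_Max[OF assms(1), of "{v, w}"] assms(2) by (simp add: adjacent_def)

lemma neighbours_eq:
  assumes "adjacent E v w" "{u\<in>V. adjacent E v u} = {w, a, b}" "{u\<in>V. adjacent E w u} = {v, c, d}"
  shows "neighbours {v, w} = {{v, a}, {v, b}, {w, c}, {w, d}} - {{v, w}}"
proof (intro set_eqI iffI)
  fix x assume "x \<in> neighbours {v, w}"
  then have x: "x \<in> E" "x \<noteq> {v, w}" "v \<in> x \<or> w \<in> x"
    by (auto simp: neighbours_def edge_adjacent_def)
  obtain s u where su: "x = {s, u}" "adjacent E s u" "s = v \<or> s = w"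
  proof -
    obtain s u where "x = {s, u}" "adjacent E s u"
      using edgeE[OF x(1)] by metis
    then show thesis
      using that[of s u] that[of u s] x(3) adjacent_sym[of s u] by (auto simp: insert_commute)
  qed
  then have u: "u \<in> {u\<in>V. adjacent E s u}"
    using adjacent_in_V by blast
  from su(3) show "x \<in> {{v, a}, {v, b}, {w, c}, {w, d}} - {{v, w}}"
  proof
    assume "s = v"
    then show ?thesis
      using u su(1) x(2) assms(2) by auto
  next
    assume "s = w"
    then show ?thesis
      using u su(1) x(2) assms(3) by (auto simp: insert_commute)
  qed
next
  have "adjacent E v a" "adjacent E v b" "adjacent E w c" "adjacent E w d"
    using assms by auto
  then show "x \<in> neighbours {v, w}" if "x \<in> {{v, a}, {v, b}, {w, c}, {w, d}} - {{v, w}}" for x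
    using that by (auto simp: neighbours_def edge_adjacent_def adjacent_def)
qed

lemma sum_neighbours:
  fixes f :: "'v set \<Rightarrow> complex"
  assumes "adjacent E v w" "{u\<in>V. adjacent E v u} = {w, a, b}" "{u\<in>V. adjacent E w u} = {v, c, d}"
    and "w \<noteq> a" "w \<noteq> b" "a \<noteq> b" "v \<noteq> c" "v \<noteq> d" "c \<noteq> d"
  shows "sum f (neighbours {v, w}) = f {v, a} + f {v, b} + f {w, c} + f {w, d}"
proof -
  have "v \<noteq> w" "v \<noteq> a" "v \<noteq> b" "w \<noteq> c" "w \<noteq> d"
    using assms by (auto simp: adjacent_def)
  then have "neighbours {v, w} = {{v, a}, {v, b}, {w, c}, {w, d}}"
    unfolding neighbours_eq[OF assms(1-3)] using assms(4-) by (auto simp: doubleton_eq_iff)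
  then show ?thesis
    using \<open>v \<noteq> w\<close> \<open>v \<noteq> a\<close> \<open>v \<noteq> b\<close> \<open>w \<noteq> c\<close> \<open>w \<noteq> d\<close> assms(4-)
    by (simp add: doubleton_eq_iff)
qed

text \<open>
  The intersection numbers of the edge graph. An edge \<open>{v, w}\<close> with \<open>v\<close> below \<open>w\<close> meets at \<open>v\<close> the
  edge to the parent of \<open>v\<close> and the one to its other child, and at \<open>w\<close> the edges to the two
  children of \<open>w\<close>. A sum over arbitrary radial functions states all the counts at once.
\<close>

lemma sum_neighbours_radial:
  fixes f :: "nat \<Rightarrow> complex"
  assumes "x \<in> E" "y \<in> E"
  shows "(\<Sum>x'\<in>neighbours x. f (edge_dist E x' y)) =
    (case edge_dist E x y of 0 \<Rightarrow> 4 * f 1 | Suc n \<Rightarrow> f n + f (Suc n) + 2 * f (Suc (Suc n)))"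
proof (cases "x = y")
  case True
  obtain v w where x: "x = {v, w}" "v \<in> V" "w \<in> V" "adjacent E v w"
    using assms edgeE by metis
  have h: "height y v = 0" "height y w = 0"
    using height_eq_0_iff[OF assms(2)] x True by auto
  obtain a b where ab: "{u\<in>V. adjacent E v u} = {w, a, b}" "w \<noteq> a" "w \<noteq> b" "a \<noteq> b"
    "height y a = 1" "height y b = 1"
  proof (rule parent_children[OF assms(2) x(2)])
    fix p a b assume *: "{u\<in>V. adjacent E v u} = {p, a, b}" "p \<noteq> a" "p \<noteq> b" "a \<noteq> b"
      "height y a = Suc (height y v)" "height y b = Suc (height y v)"
    moreover have "w \<in> {p, a, b}"
      using * x by blast
    ultimately show thesis
      using that[of a b] h by auto
  qed
  obtain c d where cd: "{u\<in>V. adjacent E w u} = {v, c, d}" "v \<noteq> c" "v \<noteq> d" "c \<noteq> d"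
    "height y c = 1" "height y d = 1"
  proof (rule parent_children[OF assms(2) x(3)])
    fix p a b assume *: "{u\<in>V. adjacent E w u} = {p, a, b}" "p \<noteq> a" "p \<noteq> b" "a \<noteq> b"
      "height y a = Suc (height y w)" "height y b = Suc (height y w)"
    moreover have "v \<in> {p, a, b}"
      using * x adjacent_sym by blast
    ultimately show thesis
      using that[of a b] h by auto
  qed
  have "adjacent E v a" "adjacent E v b" "adjacent E w c" "adjacent E w d"
    using ab cd by auto
  then have "edge_dist E {v, a} y = 1" "edge_dist E {v, b} y = 1"
    "edge_dist E {w, c} y = 1" "edge_dist E {w, d} y = 1"
    using ab(5,6) cd(5,6) h edge_dist_doubleton[OF assms(2)] by simp_all
  moreover have "edge_dist E x y = 0"
    using edge_dist_eq_0_iff[OF assms(2,1)] True by simp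
  moreover note sum_neighbours[OF x(4) ab(1) cd(1) ab(2-4) cd(2-4)]
  ultimately show ?thesis
    by (simp add: x(1))
next
  case False
  obtain v w where x: "x = {v, w}" "adjacent E v w" "height y w = Suc (height y v)"
    using False assms edge_endpoint_heights by metis
  have V: "v \<in> V" "w \<in> V"
    using x adjacent_in_V by auto
  obtain a b where ab: "{u\<in>V. adjacent E v u} = {w, a, b}" "w \<noteq> a" "w \<noteq> b" "a \<noteq> b"
    "height y a = height y v - 1" "height y b = Suc (height y v)"
  proof (rule parent_children[OF assms(2) V(1)])
    fix p a b assume *: "{u\<in>V. adjacent E v u} = {p, a, b}" "p \<noteq> a" "p \<noteq> b" "a \<noteq> b"
      "height y p = height y v - 1" "height y a = Suc (height y v)" "height y b = Suc (height y v)"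
    moreover have "w \<in> {p, a, b}"
      using * x V by blast
    ultimately consider "w = a" | "w = b"
      using x by fastforce
    then show thesis
    proof cases
      case 1
      then show thesis
        using that[of p b] * by (auto simp: insert_commute)
    next
      case 2
      then show thesis
        using that[of p a] * by (auto simp: insert_commute)
    qed
  qed
  obtain c d where cd: "{u\<in>V. adjacent E w u} = {v, c, d}" "v \<noteq> c" "v \<noteq> d" "c \<noteq> d"
    "height y c = Suc (height y w)" "height y d = Suc (height y w)"
  proof (rule parent_children[OF assms(2) V(2)])
    fix p a b assume *: "{u\<in>V. adjacent E w u} = {p, a, b}" "p \<noteq> a" "p \<noteq> b" "a \<noteq> b"
      "height y p = height y w - 1" "height y a = Suc (height y w)" "height y b = Suc (height y w)"
    moreover have "v \<in> {p, a, b}"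
      using * x V adjacent_sym by blast
    ultimately show thesis
      using that[of a b] x by auto
  qed
  have "adjacent E v a" "adjacent E v b" "adjacent E w c" "adjacent E w d"
    using ab cd by auto
  then have "edge_dist E {v, a} y = height y v" "edge_dist E {v, b} y = Suc (height y v)"
    "edge_dist E {w, c} y = Suc (Suc (height y v))" "edge_dist E {w, d} y = Suc (Suc (height y v))"
    using ab(5,6) cd(5,6) x(3) edge_dist_doubleton[OF assms(2)] by simp_all
  moreover have "edge_dist E x y = Suc (height y v)"
    using x(1,3) edge_dist_doubleton[OF assms(2) x(2)] by simp
  moreover note sum_neighbours[OF x(2) ab(1) cd(1) ab(2-4) cd(2-4)]
  ultimately show ?thesis
    by (simp add: x(1))
qed

end

section \<open>Sums over spheres of the edge graph\<close>

definition sphere_size :: "nat \<Rightarrow> complex" where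
  "sphere_size n = (if n = 0 then 1 else 2 ^ Suc n)"

context cubic_tree
begin

definition edge_sphere :: "'v set \<Rightarrow> nat \<Rightarrow> 'v set set" where
  "edge_sphere y n = {x\<in>E. edge_dist E x y = n}"

lemma edge_dist_triangle:
  assumes "x \<in> E" "y \<in> E" "z \<in> E"
  shows "edge_dist E x y \<le> edge_dist E x z + edge_dist E z y"
  using assms(1)
proof (induction "edge_dist E x z" arbitrary: x)
  case 0
  then show ?case
    using edge_dist_eq_0_iff[OF assms(3)] by simp
next
  case (Suc n)
  then obtain x' where x': "x' \<in> E" "edge_adjacent x x'" "edge_dist E x' z = n"
    using edge_dist_descent[OF assms(3)] by metis
  then show ?case
    using Suc.hyps(1)[of x'] Suc.hyps(2) edge_dist_lipschitz[OF assms(2) Suc.prems x'(1,2)] by linarith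
qed

lemma finite_neighbours:
  assumes "x \<in> E"
  shows "finite (neighbours x)"
proof (rule ccontr)
  \<comment> \<open>A sum over an infinite set is \<open>0\<close>, but the sum of the constant 1 over the neighbours is 4.\<close>
  assume "infinite (neighbours x)"
  then have "(\<Sum>x'\<in>neighbours x. 1 :: complex) = 0"
    by simp
  then show False
    using sum_neighbours_radial[OF assms assms, of "\<lambda>_. 1"] edge_dist_eq_0_iff[OF assms assms] by simp
qed

lemma edge_sphere_0: "y \<in> E \<Longrightarrow> edge_sphere y 0 = {y}"
  using edge_dist_eq_0_iff by (auto simp: edge_sphere_def)

lemma finite_edge_sphere:
  assumes "y \<in> E"
  shows "finite (edge_sphere y n)"
proof (induction n)
  case 0
  then show ?case
    using edge_sphere_0 assms by simp
next
  case (Suc n)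
  have "edge_sphere y (Suc n) \<subseteq> (\<Union>x\<in>edge_sphere y n. neighbours x)"
  proof
    fix x assume "x \<in> edge_sphere y (Suc n)"
    then have x: "x \<in> E" "edge_dist E x y = Suc n"
      by (auto simp: edge_sphere_def)
    then obtain x' where "x' \<in> E" "edge_adjacent x x'" "edge_dist E x' y = n"
      using edge_dist_descent[OF assms] by metis
    then show "x \<in> (\<Union>x\<in>edge_sphere y n. neighbours x)"
      using x by (auto simp: edge_sphere_def neighbours_def edge_adjacent_def)
  qed
  moreover have "finite (\<Union>x\<in>edge_sphere y n. neighbours x)"
    using Suc finite_neighbours by (auto simp: edge_sphere_def)
  ultimately show ?case
    by (rule finite_subset)
qed

lemma UN_edge_sphere: "(\<Union>k\<in>K. edge_sphere y k) = {x\<in>E. edge_dist E x y \<in> K}"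
  by (auto simp: edge_sphere_def)

lemma sum_UN_edge_sphere:
  assumes "y \<in> E" "finite K"
  shows "sum f {x\<in>E. edge_dist E x y \<in> K} = (\<Sum>k\<in>K. sum f (edge_sphere y k))"
  unfolding UN_edge_sphere[symmetric] using assms finite_edge_sphere
  by (intro sum.UNION_disjoint) (auto simp: edge_sphere_def)

lemma finite_edge_annulus: "y \<in> E \<Longrightarrow> finite K \<Longrightarrow> finite {x\<in>E. edge_dist E x y \<in> K}"
  unfolding UN_edge_sphere[symmetric] using finite_edge_sphere by auto

text \<open>
  Double counting of adjacent pairs: an edge \<open>x'\<close> contributes \<open>g x'\<close> once for each of its
  neighbours on the sphere, and the intersection numbers tell how many these are.
\<close>

lemma sum_edge_sphere_neighbours:
  fixes g :: "'v set \<Rightarrow> complex"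
  assumes y: "y \<in> E"
  shows "(\<Sum>x\<in>edge_sphere y n. sum g (neighbours x)) = sum g (edge_sphere y (Suc n)) +
    (case n of 0 \<Rightarrow> 0
     | Suc m \<Rightarrow> sum g (edge_sphere y n) + (if m = 0 then 4 else 2) * sum g (edge_sphere y m))"
proof -
  define B where "B = {x\<in>E. edge_dist E x y \<in> {..Suc n}}"
  define c :: "nat \<Rightarrow> complex" where
    "c k = (case k of 0 \<Rightarrow> 4 * of_bool (n = 1)
      | Suc m \<Rightarrow> of_bool (m = n) + of_bool (Suc m = n) + 2 * of_bool (Suc (Suc m) = n))" for k
  have nb: "neighbours x = {x'\<in>B. edge_adjacent x x'}" if "x \<in> edge_sphere y n" for x
  proof -
    have "edge_dist E x' y \<le> Suc n" if "x' \<in> E" "edge_adjacent x x'" for x'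
      using edge_dist_lipschitz[OF y that(1), of x] that \<open>x \<in> _\<close>
      by (auto simp: edge_sphere_def edge_adjacent_def)
    then show ?thesis
      by (auto simp: neighbours_def B_def)
  qed
  have c: "(\<Sum>x\<in>{x\<in>edge_sphere y n. edge_adjacent x x'}. g x') = g x' * c (edge_dist E x' y)"
    if "x' \<in> B" for x'
  proof -
    have x': "x' \<in> E"
      using that by (simp add: B_def)
    have "{x\<in>edge_sphere y n. edge_adjacent x x'} = {x\<in>neighbours x'. edge_dist E x y = n}"
      by (auto simp: edge_sphere_def neighbours_def edge_adjacent_def)
    then have "(\<Sum>x\<in>{x\<in>edge_sphere y n. edge_adjacent x x'}. g x')
      = (\<Sum>x\<in>neighbours x'. g x' * of_bool (edge_dist E x y = n))"
      using sum.inter_filter[OF finite_neighbours[OF x'], of "\<lambda>_. g x'" "\<lambda>x. edge_dist E x y = n"]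
      by (simp only: of_bool_def if_distrib[of "\<lambda>c. g x' * c"] mult_1_right mult_zero_right)
    also have "\<dots> = g x' * c (edge_dist E x' y)"
      unfolding sum_distrib_left[symmetric] c_def
      using sum_neighbours_radial[OF x' y, of "\<lambda>k. of_bool (k = n)"]
      by (simp split: nat.split)
    finally show ?thesis .
  qed
  have "(\<Sum>x\<in>edge_sphere y n. sum g (neighbours x))
      = (\<Sum>x\<in>edge_sphere y n. sum g {x'\<in>B. edge_adjacent x x'})"
    using nb by simp
  also have "\<dots> = (\<Sum>x'\<in>B. \<Sum>x\<in>{x\<in>edge_sphere y n. edge_adjacent x x'}. g x')"
    unfolding B_def
    by (rule sum.swap_restrict[OF finite_edge_sphere[OF y] finite_edge_annulus[OF y finite_atMost]])
  also have "\<dots> = (\<Sum>x'\<in>B. g x' * c (edge_dist E x' y))"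
    using c by (rule sum.cong[OF refl])
  also have "\<dots> = (\<Sum>k\<le>Suc n. \<Sum>x'\<in>edge_sphere y k. g x' * c (edge_dist E x' y))"
    unfolding B_def using y by (intro sum_UN_edge_sphere) auto
  also have "\<dots> = (\<Sum>k\<le>Suc n. sum g (edge_sphere y k) * c k)"
    by (auto simp: edge_sphere_def sum_distrib_right intro!: sum.cong)
  also have "\<dots> = sum g (edge_sphere y (Suc n)) +
    (case n of 0 \<Rightarrow> 0
     | Suc m \<Rightarrow> sum g (edge_sphere y n) + (if m = 0 then 4 else 2) * sum g (edge_sphere y m))"
  proof (cases n)
    case 0
    then show ?thesis
      by (simp add: c_def)
  next
    case (Suc m)
    have "(\<Sum>k<m. sum g (edge_sphere y k) * c k) = 0"
      using Suc by (intro sum.neutral) (auto simp: c_def split: nat.split)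
    moreover have "c (Suc n) = 1" "c n = 1" "c m = (if m = 0 then 4 else 2)"
      using Suc by (auto simp: c_def split: nat.split)
    ultimately show ?thesis
      using Suc by (simp add: lessThan_Suc_atMost[symmetric])
  qed
  finally show ?thesis .
qed

end

text \<open>
  By the intersection numbers, these are the conditions for \<open>x \<mapsto> \<kappa>(d(x, y))\<close> to be an
  eigenfunction of the adjacency operator of the edge graph.
\<close>

locale radial_eigenfunction =
  fixes \<mu> :: complex and \<kappa> :: "nat \<Rightarrow> complex"
  assumes initial: "4 * \<kappa> 1 = \<mu> * \<kappa> 0"
    and recurrence: "\<kappa> n + \<kappa> (Suc n) + 2 * \<kappa> (Suc (Suc n)) = \<mu> * \<kappa> (Suc n)"

lemma (in cubic_tree) sum_neighbours_eigenfunction: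
  assumes "radial_eigenfunction \<mu> \<kappa>" "x \<in> E" "y \<in> E"
  shows "(\<Sum>x'\<in>neighbours x. \<kappa> (edge_dist E x' y)) = \<mu> * \<kappa> (edge_dist E x y)"
  using sum_neighbours_radial[OF assms(2,3), of \<kappa>] radial_eigenfunction.initial[OF assms(1)]
    radial_eigenfunction.recurrence[OF assms(1)] by (simp split: nat.split)

text \<open>
  The mean value property. The sphere sums of \<open>g\<close> satisfy a three-term recurrence that starts from
  \<open>g y\<close>; the products of \<open>\<kappa>(n)\<close> with the sphere sizes satisfy the same one. The factor \<open>\<kappa> 0\<close>
  appears because \<open>\<kappa>\<close> is not normalised.
\<close>

lemma (in cubic_tree) sum_edge_sphere_eigenfunction:
  assumes "radial_eigenfunction \<mu> \<kappa>" "y \<in> E"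
    and g: "\<And>x. x \<in> E \<Longrightarrow> sum g (neighbours x) = \<mu> * g x"
  shows "\<kappa> 0 * sum g (edge_sphere y n) = sphere_size n * \<kappa> n * g y"
proof -
  interpret radial_eigenfunction \<mu> \<kappa> by fact
  define T where "T n = \<kappa> 0 * sum g (edge_sphere y n)" for n
  have step: "\<mu> * T n = T (Suc n) +
      (case n of 0 \<Rightarrow> 0 | Suc m \<Rightarrow> T n + (if m = 0 then 4 else 2) * T m)" for n
  proof -
    have "(\<Sum>x\<in>edge_sphere y n. sum g (neighbours x)) = \<mu> * sum g (edge_sphere y n)"
      unfolding sum_distrib_left using g by (intro sum.cong) (auto simp: edge_sphere_def)
    then have "\<kappa> 0 * (\<mu> * sum g (edge_sphere y n)) = \<kappa> 0 * (sum g (edge_sphere y (Suc n)) +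
        (case n of 0 \<Rightarrow> 0
         | Suc m \<Rightarrow> sum g (edge_sphere y n) + (if m = 0 then 4 else 2) * sum g (edge_sphere y m)))"
      using sum_edge_sphere_neighbours[OF assms(2), of g n] by simp
    then show ?thesis
      by (cases n) (auto simp: T_def algebra_simps simp del: mult_cancel_left)
  qed
  have "T n = sphere_size n * \<kappa> n * g y"
  proof (induction n rule: less_induct)
    case (less n)
    have T0: "T 0 = \<kappa> 0 * g y"
      using assms(2) by (simp add: T_def edge_sphere_0)
    have T1: "T 1 = 4 * \<kappa> 1 * g y"
      using step[of 0] initial by (simp add: T0 mult.assoc)
    consider "n = 0" | "n = 1" | m where "n = Suc (Suc m)"
      by (metis One_nat_def not0_implies_Suc)
    then show ?case
    proof cases
      case 1
      then show ?thesis
        by (simp add: T0 sphere_size_def)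
    next
      case 2
      then show ?thesis
        by (simp add: T1[unfolded One_nat_def] sphere_size_def)
    next
      case 3
      have "\<mu> * T (Suc m) = T n + T (Suc m) + (if m = 0 then 4 else 2) * T m"
        using step[of "Suc m"] 3 by simp
      then have "T n = (\<mu> * \<kappa> (Suc m) - \<kappa> (Suc m) - \<kappa> m) * 2 ^ Suc (Suc m) * g y"
        using less.IH[of m] less.IH[of "Suc m"] 3
        by (auto simp: sphere_size_def algebra_simps split: if_splits)
      also have "\<mu> * \<kappa> (Suc m) - \<kappa> (Suc m) - \<kappa> m = 2 * \<kappa> n"
        using recurrence[of m] 3 by (simp add: algebra_simps)
      finally show ?thesis
        using 3 by (simp add: sphere_size_def)
    qed
  qed
  then show ?thesis
    by (simp add: T_def)
qed

text \<open>
  The constant function 1 is an eigenfunction for the eigenvalue 4.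
\<close>

lemma (in cubic_tree) card_edge_sphere:
  assumes "y \<in> E"
  shows "of_nat (card (edge_sphere y n)) = sphere_size n"
proof -
  have one: "radial_eigenfunction 4 (\<lambda>_. 1)"
    by unfold_locales simp_all
  show ?thesis
    using sum_edge_sphere_eigenfunction[OF one assms, of "\<lambda>_. 1" n]
      sum_neighbours_eigenfunction[OF one _ assms] by simp
qed

text \<open>
  The symmetric difference of the two balls lies in an annulus about \<open>y\<close> of bounded width, and the
  decay of \<open>f\<close> balances the exponential growth of the spheres, so that each sphere contributes at
  most \<open>2 C\<close>.
\<close>

lemma (in cubic_tree) ball_sum_base_point:
  fixes f :: "'v set \<Rightarrow> complex"
  assumes "x0 \<in> E" "y \<in> E" and f: "\<And>x. x \<in> E \<Longrightarrow> norm (f x) \<le> C * (1/2) ^ edge_dist E x y"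
  shows "\<exists>K. \<forall>N. norm (sum f {x\<in>E. edge_dist E x x0 \<le> N} - sum f {x\<in>E. edge_dist E x y \<le> N}) \<le> K"
proof (intro exI allI)
  define D where "D = edge_dist E y x0 + edge_dist E x0 y"
  fix N
  define A where "A = {x\<in>E. edge_dist E x x0 \<le> N}"
  define B where "B = {x\<in>E. edge_dist E x y \<le> N}"
  have fin: "finite A" "finite B"
    using finite_edge_annulus[of x0 "{..N}"] finite_edge_annulus[of y "{..N}"] assms
    by (auto simp: A_def B_def)
  have C: "0 \<le> C"
    using f[OF assms(2)] edge_dist_eq_0_iff[OF assms(2,2)] norm_ge_zero[of "f y"]
    by (simp del: norm_ge_zero)
  have sub: "(A - B) \<union> (B - A) \<subseteq> {x\<in>E. edge_dist E x y \<in> {N - D..N + D}}"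
    using edge_dist_triangle[OF _ assms(1,2)] edge_dist_triangle[OF _ assms(2,1)]
    by (fastforce simp: A_def B_def D_def)
  have sphere: "(\<Sum>x\<in>edge_sphere y k. norm (f x)) \<le> 2 * C" for k
  proof -
    have "real (card (edge_sphere y k)) = (if k = 0 then 1 else 2 ^ Suc k)"
    proof -
      have "complex_of_real (real (card (edge_sphere y k))) = of_real (if k = 0 then 1 else 2 ^ Suc k)"
        using card_edge_sphere[OF assms(2), of k] by (simp add: sphere_size_def)
      then show ?thesis
        by (simp only: of_real_eq_iff)
    qed
    then have "real (card (edge_sphere y k)) * (1/2) ^ k \<le> 2"
      by (simp add: power_one_over)
    then have "real (card (edge_sphere y k)) * (1/2) ^ k * C \<le> 2 * C"
      using C by (intro mult_right_mono)
    moreover have "(\<Sum>x\<in>edge_sphere y k. norm (f x)) \<le> (\<Sum>x\<in>edge_sphere y k. C * (1/2) ^ k)"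
      using f by (intro sum_mono) (auto simp: edge_sphere_def)
    ultimately show ?thesis
      by (simp add: mult_ac)
  qed
  have "sum f A - sum f B = sum f (A - B) - sum f (B - A)"
    using fin sum.Int_Diff[of A f B] sum.Int_Diff[of B f A] by (simp add: Int_commute)
  then have "norm (sum f A - sum f B) \<le> norm (sum f (A - B)) + norm (sum f (B - A))"
    by (simp add: norm_triangle_ineq4)
  also have "\<dots> \<le> (\<Sum>x\<in>A - B. norm (f x)) + (\<Sum>x\<in>B - A. norm (f x))"
    by (intro add_mono norm_sum)
  also have "\<dots> = (\<Sum>x\<in>(A - B) \<union> (B - A). norm (f x))"
    using fin by (intro sum.union_disjoint[symmetric]) auto
  also have "\<dots> \<le> (\<Sum>x\<in>{x\<in>E. edge_dist E x y \<in> {N - D..N + D}}. norm (f x))"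
    using sub assms(2) by (intro sum_mono2 finite_edge_annulus) auto
  also have "\<dots> = (\<Sum>k\<in>{N - D..N + D}. \<Sum>x\<in>edge_sphere y k. norm (f x))"
    using assms(2) by (intro sum_UN_edge_sphere) auto
  also have "\<dots> \<le> (\<Sum>k\<in>{N - D..N + D}. 2 * C)"
    using sphere by (intro sum_mono)
  also have "\<dots> \<le> real (2 * D + 1) * (2 * C)"
  proof -
    have "card {N - D..N + D} \<le> 2 * D + 1"
      by simp
    then show ?thesis
      using C unfolding sum_constant by (intro mult_right_mono of_nat_mono) auto
  qed
  finally show "norm (sum f A - sum f B) \<le> real (2 * D + 1) * (2 * C)" .
qed

lemma tendsto_average_bounded_diff:
  fixes s s' :: "nat \<Rightarrow> complex"
  assumes "\<And>N. norm (s N - s' N) \<le> K" "(\<lambda>N. 1 / of_nat N * s' N) \<longlonglongrightarrow> l"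
  shows "(\<lambda>N. 1 / of_nat N * s N) \<longlonglongrightarrow> l"
proof -
  have "(\<lambda>N. 1 / of_nat N * (s N - s' N)) \<longlonglongrightarrow> 0"
  proof (rule Lim_null_comparison)
    show "\<forall>\<^sub>F N in sequentially. norm (1 / of_nat N * (s N - s' N)) \<le> K * (1 / real N)"
      using assms(1) by (intro always_eventually allI) (simp add: norm_divide norm_mult divide_right_mono)
    show "(\<lambda>N. K * (1 / real N)) \<longlonglongrightarrow> 0"
      using tendsto_mult_right_zero[OF lim_1_over_n[where 'a = real], of K] by simp
  qed
  from tendsto_add[OF this assms(2)] show ?thesis
    by (simp add: algebra_simps diff_divide_distrib)
qed

text \<open>
  On a ball about \<open>y'\<close>, one factor is constant on each sphere and the mean value property evaluates
  the sum of the other one. The base point \<open>x0\<close> is then reached by a bounded change.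
\<close>

lemma (in cubic_tree) pair_mean:
  assumes "radial_eigenfunction \<mu> \<kappa>" and y: "x0 \<in> E" "y \<in> E" "y' \<in> E" and "\<kappa> 0 \<noteq> 0"
    and decay: "\<And>n. norm (\<kappa> n) \<le> M * (1 / sqrt 2) ^ n"
    and mean: "(\<lambda>N. 1 / of_nat N * (\<Sum>n\<le>N. sphere_size n * (\<kappa> n)\<^sup>2)) \<longlonglongrightarrow> l"
  shows "(\<lambda>N. 1 / of_nat N *
      (\<Sum>x\<in>{x\<in>E. edge_dist E x x0 \<le> N}. \<kappa> (edge_dist E x y) * \<kappa> (edge_dist E x y')))
    \<longlonglongrightarrow> l / \<kappa> 0 * \<kappa> (edge_dist E y' y)"
proof -
  interpret radial_eigenfunction \<mu> \<kappa> by fact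
  define D where "D = edge_dist E y' y"
  define \<rho> where "\<rho> = 1 / sqrt 2"
  have \<rho>: "0 < \<rho>" "\<rho> \<le> 1" "\<rho> * \<rho> = 1/2"
    by (simp_all add: \<rho>_def)
  define f where "f x = \<kappa> (edge_dist E x y) * \<kappa> (edge_dist E x y')" for x
  have M: "0 \<le> M"
    using decay[of 0] norm_ge_zero[of "\<kappa> 0"] by (simp del: norm_ge_zero)
  have f: "norm (f x) \<le> M\<^sup>2 / \<rho> ^ edge_dist E y y' * (1/2) ^ edge_dist E x y'" if x: "x \<in> E" for x
  proof -
    have "\<rho> ^ edge_dist E x y * \<rho> ^ edge_dist E y y' \<le> \<rho> ^ edge_dist E x y'"
      unfolding power_add[symmetric] using edge_dist_triangle[OF x y(3,2)] \<rho>
      by (intro power_decreasing) auto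
    then have *: "\<rho> ^ edge_dist E x y \<le> \<rho> ^ edge_dist E x y' / \<rho> ^ edge_dist E y y'"
      using \<rho> by (simp add: pos_le_divide_eq)
    have "norm (f x) \<le> (M * \<rho> ^ edge_dist E x y) * (M * \<rho> ^ edge_dist E x y')"
      unfolding f_def norm_mult using decay M \<rho> by (intro mult_mono) (auto simp: \<rho>_def)
    also have "\<dots> \<le> (M * (\<rho> ^ edge_dist E x y' / \<rho> ^ edge_dist E y y')) * (M * \<rho> ^ edge_dist E x y')"
      using * M \<rho> by (intro mult_mono) auto
    also have "\<dots> = M\<^sup>2 / \<rho> ^ edge_dist E y y' * (\<rho> * \<rho>) ^ edge_dist E x y'"
      by (simp add: power2_eq_square power_mult_distrib)
    finally show ?thesis
      unfolding \<rho> .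
  qed
  have centred: "sum f {x\<in>E. edge_dist E x y' \<le> N}
    = (\<Sum>n\<le>N. sphere_size n * (\<kappa> n)\<^sup>2) * (\<kappa> (edge_dist E y' y) / \<kappa> 0)" for N
  proof -
    have "sum f {x\<in>E. edge_dist E x y' \<le> N} = (\<Sum>n\<le>N. sum f (edge_sphere y' n))"
      using sum_UN_edge_sphere[OF y(3), of "{..N}" f] by simp
    also have "\<dots> = (\<Sum>n\<le>N. sphere_size n * (\<kappa> n)\<^sup>2 * (\<kappa> (edge_dist E y' y) / \<kappa> 0))"
    proof (intro sum.cong refl)
      fix n
      have "sum f (edge_sphere y' n) = \<kappa> n * (\<Sum>x\<in>edge_sphere y' n. \<kappa> (edge_dist E x y))"
        unfolding f_def sum_distrib_left by (intro sum.cong) (auto simp: edge_sphere_def)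
      moreover have "\<kappa> 0 * (\<Sum>x\<in>edge_sphere y' n. \<kappa> (edge_dist E x y))
          = sphere_size n * \<kappa> n * \<kappa> (edge_dist E y' y)"
        using sum_neighbours_eigenfunction[OF assms(1) _ y(2)]
        by (intro sum_edge_sphere_eigenfunction[OF assms(1) y(3)])
      ultimately show "sum f (edge_sphere y' n)
          = sphere_size n * (\<kappa> n)\<^sup>2 * (\<kappa> (edge_dist E y' y) / \<kappa> 0)"
        using \<open>\<kappa> 0 \<noteq> 0\<close> by (simp add: field_simps power2_eq_square)
    qed
    finally show ?thesis
      unfolding sum_distrib_right .
  qed
  have "(\<lambda>N. 1 / of_nat N * sum f {x\<in>E. edge_dist E x y' \<le> N})
      \<longlonglongrightarrow> l * (\<kappa> (edge_dist E y' y) / \<kappa> 0)"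
    unfolding centred using tendsto_mult_right[OF mean] by (simp only: mult.assoc[symmetric])
  moreover obtain K where K:
    "\<And>N. norm (sum f {x\<in>E. edge_dist E x x0 \<le> N} - sum f {x\<in>E. edge_dist E x y' \<le> N}) \<le> K"
    using ball_sum_base_point[OF y(1,3) f] by blast
  ultimately show ?thesis
    using tendsto_average_bounded_diff[OF K] by (simp only: f_def[symmetric] times_divide_eq_left
        times_divide_eq_right)
qed

section \<open>The spectral kernel\<close>

lemma average_powers_tendsto_0:
  fixes z :: complex
  assumes "norm z = 1" "z \<noteq> 1"
  shows "(\<lambda>N. 1 / of_nat N * (\<Sum>n\<le>N. z ^ n)) \<longlonglongrightarrow> 0"
proof (rule Lim_null_comparison)
  define K where "K = 2 / norm (1 - z)"
  have "norm (\<Sum>n\<le>N. z ^ n) \<le> K" for N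
  proof -
    have "norm (1 - z ^ Suc N) \<le> 2"
      using norm_triangle_ineq4[of 1 "z ^ Suc N"] assms(1) by (simp add: norm_power norm_mult)
    moreover have "(\<Sum>n\<le>N. z ^ n) = (1 - z ^ Suc N) / (1 - z)"
      using assms(2) by (subst sum_gp0) simp
    ultimately show ?thesis
      by (simp add: K_def norm_divide divide_right_mono)
  qed
  then show "\<forall>\<^sub>F N in sequentially.
      norm (1 / of_nat N * (\<Sum>n\<le>N. z ^ n)) \<le> K * (1 / real N)"
    by (intro always_eventually allI) (simp add: norm_mult norm_divide divide_right_mono)
  show "(\<lambda>N. K * (1 / real N)) \<longlonglongrightarrow> 0"
    using tendsto_mult_right_zero[OF lim_1_over_n[where 'a = real]] by blast
qed

text \<open>
  In the expansion of the square the mixed term \<open>4 a b (2 q r)^n\<close> is constant, while \<open>2 q^2\<close> and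
  \<open>2 r^2\<close> lie on the unit circle and differ from 1, so that their powers average out.
\<close>

lemma sphere_weighted_mean:
  fixes a b q r :: complex
  assumes "q * r = 1/2" "q \<noteq> r" "norm q = 1 / sqrt 2" "norm r = 1 / sqrt 2"
  shows "(\<lambda>N. 1 / of_nat N * (\<Sum>n\<le>N. sphere_size n * (a * q ^ n + b * r ^ n)\<^sup>2)) \<longlonglongrightarrow> 4 * a * b"
proof -
  define avg :: "complex \<Rightarrow> nat \<Rightarrow> complex" where "avg z N = 1 / of_nat N * (\<Sum>n\<le>N. z ^ n)" for z N
  have summand: "sphere_size n * (a * q ^ n + b * r ^ n)\<^sup>2
      = 2 * a\<^sup>2 * (2 * q\<^sup>2) ^ n + 2 * b\<^sup>2 * (2 * r\<^sup>2) ^ n + 4 * a * b * 1 ^ n - (a + b)\<^sup>2 * of_bool (n = 0)" for n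
  proof (cases "n = 0")
    case False
    have "(2::complex) ^ n * (q ^ n * r ^ n) = (2 * (q * r)) ^ n"
      by (simp only: power_mult_distrib)
    then have "(2::complex) ^ n * (q ^ n * r ^ n) = 1"
      using assms(1) by simp
    moreover have "2 * c * (a * x + b * y)\<^sup>2 = 2 * a\<^sup>2 * (c * x\<^sup>2) + 2 * b\<^sup>2 * (c * y\<^sup>2) + 4 * a * b"
      if "c * (x * y) = 1" for c x y :: complex
      using that by algebra
    ultimately have "2 * 2 ^ n * (a * q ^ n + b * r ^ n)\<^sup>2
        = 2 * a\<^sup>2 * (2 ^ n * (q ^ n)\<^sup>2) + 2 * b\<^sup>2 * (2 ^ n * (r ^ n)\<^sup>2) + 4 * a * b"
      by blast
    moreover have "(2 * s\<^sup>2) ^ n = 2 ^ n * (s ^ n)\<^sup>2" for s :: complex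
      by (simp only: power_mult_distrib power_mult[symmetric] mult.commute[of n])
    ultimately show ?thesis
      using False by (simp add: sphere_size_def)
  qed (simp add: sphere_size_def power2_eq_square algebra_simps)
  have delta: "(\<Sum>n\<le>N. of_bool (n = 0)) = (1 :: complex)" for N :: nat
    by (induction N) auto
  define S :: "complex \<Rightarrow> nat \<Rightarrow> complex" where "S z N = (\<Sum>n\<le>N. z ^ n)" for z N
  have eq: "1 / of_nat N * (\<Sum>n\<le>N. sphere_size n * (a * q ^ n + b * r ^ n)\<^sup>2)
      = 2 * a\<^sup>2 * avg (2 * q\<^sup>2) N + 2 * b\<^sup>2 * avg (2 * r\<^sup>2) N + 4 * a * b * avg 1 N
        - (a + b)\<^sup>2 * (1 / of_nat N)" for N
    unfolding summand sum_subtractf sum.distrib sum_distrib_left[symmetric] avg_def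
      delta S_def[symmetric] by (simp only: algebra_simps mult_1_left mult_1_right)
  have "q \<noteq> 0" "r \<noteq> 0"
    using assms(1) by auto
  have "q\<^sup>2 \<noteq> q * r" "r\<^sup>2 \<noteq> q * r"
    using assms(2) \<open>q \<noteq> 0\<close> \<open>r \<noteq> 0\<close> by (auto simp: power2_eq_square)
  then have "2 * q\<^sup>2 \<noteq> 1" "2 * r\<^sup>2 \<noteq> 1"
    using assms(1) by (auto simp: mult.commute)
  moreover have "norm (2 * q\<^sup>2) = 1" "norm (2 * r\<^sup>2) = 1"
    using assms(3,4) by (simp_all add: norm_mult norm_power power_divide)
  ultimately have "avg (2 * q\<^sup>2) \<longlonglongrightarrow> 0" "avg (2 * r\<^sup>2) \<longlonglongrightarrow> 0"
    unfolding avg_def using average_powers_tendsto_0 by blast+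
  moreover have "avg 1 \<longlonglongrightarrow> 1"
  proof -
    have "(\<lambda>N. 1 + 1 / of_nat N :: complex) \<longlonglongrightarrow> 1 + 0"
      by (intro tendsto_intros lim_1_over_n)
    moreover have "\<forall>\<^sub>F N in sequentially. 1 + 1 / of_nat N = avg 1 N"
      using eventually_gt_at_top[of 0] by eventually_elim (simp add: avg_def field_simps)
    ultimately show ?thesis
      by (simp add: Lim_transform_eventually)
  qed
  ultimately have "(\<lambda>N. 2 * a\<^sup>2 * avg (2 * q\<^sup>2) N + 2 * b\<^sup>2 * avg (2 * r\<^sup>2) N + 4 * a * b * avg 1 N
      - (a + b)\<^sup>2 * (1 / of_nat N)) \<longlonglongrightarrow> 2 * a\<^sup>2 * 0 + 2 * b\<^sup>2 * 0 + 4 * a * b * 1 - (a + b)\<^sup>2 * 0"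
    by (intro tendsto_intros lim_1_over_n)
  then show ?thesis
    unfolding eq by simp
qed

lemma radial_eigenfunction_two_exponentials:
  fixes q r :: complex
  assumes "q * r = 1/2" and "4 * (a * q + b * r) = (1 + 2 * (q + r)) * (a + b)"
  shows "radial_eigenfunction (1 + 2 * (q + r)) (\<lambda>n. a * q ^ n + b * r ^ n)"
proof
  fix n
  have "1 + q + 2 * q\<^sup>2 = (1 + 2 * (q + r)) * q" "1 + r + 2 * r\<^sup>2 = (1 + 2 * (q + r)) * r"
    using assms(1) by (simp_all add: power2_eq_square algebra_simps)
  then have "a * q ^ n * (1 + q + 2 * q\<^sup>2) + b * r ^ n * (1 + r + 2 * r\<^sup>2)
      = a * q ^ n * ((1 + 2 * (q + r)) * q) + b * r ^ n * ((1 + 2 * (q + r)) * r)"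
    by simp
  then show "a * q ^ n + b * r ^ n + (a * q ^ Suc n + b * r ^ Suc n)
      + 2 * (a * q ^ Suc (Suc n) + b * r ^ Suc (Suc n))
      = (1 + 2 * (q + r)) * (a * q ^ Suc n + b * r ^ Suc n)"
    by (simp add: power2_eq_square algebra_simps)
qed (use assms(2) in simp)

text \<open>
  The coefficient of \<open>q^n\<close> in the kernel is \<open>c(z) (2 + q + 1/q) / (3 (6 - \<lambda>))\<close>, written in terms of
  \<open>q\<close> and \<open>r\<close> by means of \<open>1/q = 2 r\<close> and \<open>6 - \<lambda> = 3 + 2 (q + r)\<close>. The coefficient of \<open>r^n\<close> arises
  by exchanging \<open>q\<close> and \<open>r\<close>, that is \<open>z\<close> and \<open>1 - z\<close>.
\<close>

definition kernel_coeff :: "complex \<Rightarrow> complex \<Rightarrow> complex" where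
  "kernel_coeff q r = (2 * q - r) * (2 + q + 2 * r) / (3 * (q - r) * (3 * (3 + 2 * (q + r))))"

text \<open>
  The second identity is the initial condition of a radial eigenfunction. The third one is the
  constant of the theorem: for \<open>\<lambda> = 3 - 2 (q + r)\<close> its right-hand side is \<open>b(\<lambda>)\<close>.
\<close>

lemma kernel_coeff_identities:
  fixes q r :: complex
  assumes "q * r = 1/2" "q \<noteq> r" "3 + 2 * (q + r) \<noteq> 0"
  shows "kernel_coeff q r + kernel_coeff r q = 2/9"
    and "4 * (kernel_coeff q r * q + kernel_coeff r q * r)
      = (1 + 2 * (q + r)) * (kernel_coeff q r + kernel_coeff r q)"
    and "648 * (kernel_coeff q r * kernel_coeff r q) = 8 * (9 - 4 * (q + r)\<^sup>2) / (8 - 4 * (q + r)\<^sup>2)"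
proof -
  define d where "d = 3 * (q - r) * (3 * (3 + 2 * (q + r)))"
  define x where "x = (2 * q - r) * (2 + q + 2 * r)"
  define y where "y = (2 * r - q) * (2 + r + 2 * q)"
  have d: "d \<noteq> 0"
    unfolding d_def mult_eq_0_iff using assms(2,3) by simp
  have kr: "kernel_coeff q r = x / d"
    by (simp only: kernel_coeff_def d_def x_def)
  have "3 * (r - q) * (3 * (3 + 2 * (r + q))) = - d"
    by (simp add: d_def algebra_simps)
  then have rk: "kernel_coeff r q = - y / d"
    by (simp only: kernel_coeff_def y_def) simp
  have "9 * (x - y) = 2 * d"
    by (simp add: x_def y_def d_def algebra_simps)
  then show sum: "kernel_coeff q r + kernel_coeff r q = 2/9"
    unfolding kr rk using d by (simp add: field_simps)
  have "36 * (x * q - y * r) = (1 + 2 * (q + r)) * 2 * d"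
    using assms(1) unfolding x_def y_def d_def by algebra
  then have "4 * (x * q - y * r) / d = (1 + 2 * (q + r)) * (2/9)"
    using d by (simp add: nonzero_divide_eq_eq)
  then show "4 * (kernel_coeff q r * q + kernel_coeff r q * r)
      = (1 + 2 * (q + r)) * (kernel_coeff q r + kernel_coeff r q)"
    unfolding sum unfolding kr rk by (simp add: diff_divide_distrib right_diff_distrib)
  have disc: "(q - r)\<^sup>2 = (q + r)\<^sup>2 - 2"
    using assms(1) by algebra
  have nz: "8 - 4 * (q + r)\<^sup>2 \<noteq> 0"
    using assms(2) disc by (auto simp: algebra_simps)
  have "- (648 * (x * y)) * (8 - 4 * (q + r)\<^sup>2) = 8 * (9 - 4 * (q + r)\<^sup>2) * d\<^sup>2"
    using assms(1) unfolding x_def y_def d_def by algebra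
  moreover have "648 * (kernel_coeff q r * kernel_coeff r q) = - (648 * (x * y)) / d\<^sup>2"
    by (simp add: kr rk power2_eq_square)
  ultimately show "648 * (kernel_coeff q r * kernel_coeff r q)
      = 8 * (9 - 4 * (q + r)\<^sup>2) / (8 - 4 * (q + r)\<^sup>2)"
    using d nz frac_eq_eq[of "d\<^sup>2" "8 - 4 * (q + r)\<^sup>2"] by (metis power_not_zero)
qed

lemma psi_two_exponentials:
  fixes z q r :: complex
  assumes q: "q = 2 powr (- z)" and r: "r = 2 powr (z - 1)" and "q \<noteq> r" "3 + 2 * (q + r) \<noteq> 0"
  shows "psi z (int n) / (3 * (3 + 2 * (q + r))) = kernel_coeff q r * q ^ n + kernel_coeff r q * r ^ n"
proof -
  have q1: "2 powr (1 - z) = 2 * q" and r1: "2 powr z = 2 * r"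
    unfolding q r using powr_add[of "2::complex" 1 "- z"] powr_add[of "2::complex" 1 "z - 1"] by simp_all
  have c: "c_fun z = (2 * q - r) / (3 * (q - r))" "c_fun (1 - z) = (2 * r - q) / (3 * (r - q))"
    by (simp_all add: c_fun_def q1 r1 flip: q r)
  have qn: "2 powr (- of_nat n * z) = q ^ n" and rn: "2 powr (- of_nat n * (1 - z)) = r ^ n" for n
    unfolding q r powr_def by (simp_all flip: exp_of_nat_mult) (simp_all add: algebra_simps)
  have phi0: "phi z (int n) = c_fun z * q ^ n + c_fun (1 - z) * r ^ n" for n
    unfolding phi_def using qn rn by simp
  have "2 powr (- of_int (int n - 1) * z) = q ^ n * (2 * r)"
    "2 powr (- of_int (int n - 1) * (1 - z)) = r ^ n * (2 * q)"
  proof -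
    have "2 powr (- of_int (int n - 1) * w) = 2 powr (- of_nat n * w) * 2 powr w" for w :: complex
      unfolding powr_add[symmetric] by (rule arg_cong) (simp add: algebra_simps)
    then show "2 powr (- of_int (int n - 1) * z) = q ^ n * (2 * r)"
      "2 powr (- of_int (int n - 1) * (1 - z)) = r ^ n * (2 * q)"
      by (simp_all only: qn rn q1 r1)
  qed
  then have "phi z (int n - 1) = c_fun z * (q ^ n * (2 * r)) + c_fun (1 - z) * (r ^ n * (2 * q))"
    unfolding phi_def by simp
  moreover have "phi z (int n + 1) = c_fun z * (q ^ n * q) + c_fun (1 - z) * (r ^ n * r)"
    using phi0[of "Suc n"] by (simp add: mult_ac add.commute)
  ultimately have "psi z (int n) = c_fun z * (2 + q + 2 * r) * q ^ n + c_fun (1 - z) * (2 + r + 2 * q) * r ^ n"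
    unfolding psi_def phi0 by (simp add: algebra_simps)
  moreover have "c_fun z * (2 + q + 2 * r) / (3 * (3 + 2 * (q + r))) = kernel_coeff q r"
    "c_fun (1 - z) * (2 + r + 2 * q) / (3 * (3 + 2 * (q + r))) = kernel_coeff r q"
    by (simp_all only: c kernel_coeff_def times_divide_eq_left divide_divide_eq_left add.commute[of q r])
  ultimately show ?thesis
    by (simp only: add_divide_distrib times_divide_eq_left[symmetric])
qed

lemma two_powr_critical_line:
  fixes t :: real
  shows "2 powr (- (1/2 + \<i> * of_real t)) = of_real (1 / sqrt 2) * cis (- (t * ln 2))"
    and "2 powr ((1/2 + \<i> * of_real t) - 1) = of_real (1 / sqrt 2) * cis (t * ln 2)"
proof -
  have *: "2 powr (- (1/2) + \<i> * of_real s) = of_real (1 / sqrt 2) * cis (s * ln 2)" for s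
  proof -
    have "ln (2::complex) = of_real (ln 2)"
      using Ln_of_real[of 2] by simp
    then have "2 powr (- (1/2) + \<i> * of_real s) = exp (of_real (- (ln 2 / 2)) + \<i> * of_real (s * ln 2))"
      by (simp add: powr_def algebra_simps)
    also have "\<dots> = of_real (exp (- (ln 2 / 2))) * cis (s * ln 2)"
      by (simp only: exp_add exp_of_real cis_conv_exp)
    also have "exp (- (ln 2 / 2)) = 1 / sqrt 2"
      by (simp add: ln_sqrt[symmetric] exp_minus inverse_eq_divide)
    finally show ?thesis .
  qed
  show "2 powr (- (1/2 + \<i> * of_real t)) = of_real (1 / sqrt 2) * cis (- (t * ln 2))"
    using *[of "- t"] by simp
  show "2 powr ((1/2 + \<i> * of_real t) - 1) = of_real (1 / sqrt 2) * cis (t * ln 2)"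
    using *[of t] by (simp add: algebra_simps)
qed

lemma spectral_kernel:
  fixes t lam :: real
  assumes "lam = 3 - 2 * sqrt 2 * cos (t * ln 2)" "0 < t" "t < pi / ln 2"
  obtains q r a b :: complex where
    "\<forall>n. psi (1/2 + \<i> * of_real t) (int n) / of_real (3 * (6 - lam)) = a * q ^ n + b * r ^ n"
    "q * r = 1/2" "q \<noteq> r" "norm q = 1 / sqrt 2" "norm r = 1 / sqrt 2" "cnj q = r" "cnj a = b"
    "radial_eigenfunction (1 + 2 * (q + r)) (\<lambda>n. a * q ^ n + b * r ^ n)"
    "a + b = 2/9" "648 * (a * b) = of_real (b_fun lam)" "b_fun lam \<noteq> 0"
proof -
  define \<theta> where "\<theta> = t * ln 2"
  define q where "q = of_real (1 / sqrt 2) * cis (- \<theta>)"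
  define r where "r = of_real (1 / sqrt 2) * cis \<theta>"
  have \<theta>: "0 < \<theta>" "\<theta> < pi"
    using assms(2,3) by (simp_all add: \<theta>_def field_simps)
  have cnj: "cnj q = r" "cnj r = q"
    by (simp_all add: q_def r_def cis_cnj)
  have norm: "norm q = 1 / sqrt 2" "norm r = 1 / sqrt 2"
    by (simp_all add: q_def r_def norm_mult norm_divide)
  have "q * r = of_real ((1 / sqrt 2) * (1 / sqrt 2)) * (cis (- \<theta>) * cis \<theta>)"
    unfolding q_def r_def by (simp only: of_real_mult mult_ac)
  then have qr: "q * r = 1/2"
    by (simp add: cis_mult)
  have "Im r = sin \<theta> / sqrt 2" "Im q = - (sin \<theta> / sqrt 2)"
    by (simp_all add: q_def r_def)
  then have neq: "q \<noteq> r"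
    using sin_gt_zero[OF \<theta>] by (auto simp: complex_eq_iff field_simps)
  \<comment> \<open>Since \<open>sin \<theta>\<close> is not zero, \<open>w\<^sup>2 < 2\<close>; this keeps both \<open>3 + 2 (q + r)\<close> and the
    numerator and denominator of \<open>b_fun lam\<close> away from zero.\<close>
  define w where "w = sqrt 2 * cos \<theta>"
  have lam: "lam = 3 - 2 * w"
    by (simp add: assms(1) w_def \<theta>_def)
  have sum: "q + r = of_real w"
  proof -
    have "cis (- \<theta>) + cis \<theta> = of_real (2 * cos \<theta>)"
      by (simp add: complex_eq_iff)
    then have "q + r = of_real (1 / sqrt 2 * (2 * cos \<theta>))"
      unfolding q_def r_def distrib_left[symmetric] of_real_mult by simp
    also have "1 / sqrt 2 * (2 * cos \<theta>) = 2 / sqrt 2 * cos \<theta>"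
      by simp
    also have "2 / sqrt 2 = sqrt 2"
      by (rule real_div_sqrt) simp
    finally show ?thesis
      by (simp only: w_def)
  qed
  have w2: "w\<^sup>2 = 2 - 2 * (sin \<theta>)\<^sup>2"
    by (simp add: w_def power_mult_distrib cos_squared_eq)
  have sin: "(sin \<theta>)\<^sup>2 > 0"
    using sin_gt_zero[OF \<theta>] by simp
  have nz: "3 + 2 * (q + r) \<noteq> 0"
  proof
    assume "3 + 2 * (q + r) = 0"
    then have "complex_of_real (3 + 2 * w) = of_real 0"
      by (simp add: sum)
    then have "w = - (3/2)"
      unfolding of_real_eq_iff by simp
    then have "w\<^sup>2 = 9/4"
      by (simp add: power2_eq_square)
    then show False
      using w2 sin by simp
  qed
  have b: "b_fun lam = 8 * (9 - 4 * w\<^sup>2) / (8 - 4 * w\<^sup>2)"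
  proof -
    have "- lam\<^sup>2 + 6 * lam = 9 - 4 * w\<^sup>2"
      by (simp add: lam power2_eq_square algebra_simps)
    then show ?thesis
      by (simp add: b_fun_def)
  qed
  have "9 - 4 * w\<^sup>2 > 0" "8 - 4 * w\<^sup>2 > 0"
    using sin w2 by linarith+
  then have "b_fun lam \<noteq> 0"
    unfolding b by simp
  moreover have "psi (1/2 + \<i> * of_real t) (int n) / of_real (3 * (6 - lam))
      = kernel_coeff q r * q ^ n + kernel_coeff r q * r ^ n" for n
  proof -
    have "of_real (3 * (6 - lam)) = 3 * (3 + 2 * (q + r))"
      by (simp add: lam sum)
    moreover have "q = 2 powr (- (1/2 + \<i> * of_real t))" "r = 2 powr ((1/2 + \<i> * of_real t) - 1)"
      unfolding two_powr_critical_line q_def r_def \<theta>_def by (rule refl)+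
    ultimately show ?thesis
      using psi_two_exponentials neq nz by metis
  qed
  moreover have "cnj (kernel_coeff q r) = kernel_coeff r q"
    by (simp add: kernel_coeff_def cnj add.commute)
  moreover have "648 * (kernel_coeff q r * kernel_coeff r q) = of_real (b_fun lam)"
    unfolding kernel_coeff_identities(3)[OF qr neq nz] b sum by simp
  ultimately show thesis
    using that[of "kernel_coeff q r" q "kernel_coeff r q" r] qr neq norm cnj(1)
      radial_eigenfunction_two_exponentials[OF qr kernel_coeff_identities(2)[OF qr neq nz]]
      kernel_coeff_identities(1)[OF qr neq nz] by blast
qed

section \<open>The pairing identity\<close>

theorem theorem4p23:
  fixes V :: "'v set" and E :: "'v set set"
    and t lam :: real and F :: "'v set \<Rightarrow> complex"
  assumes "tree V E" and "regular 3 V E"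
    and "lam \<in> interior {3 - 2 * sqrt 2 .. 3 + 2 * sqrt 2}"
    and "lam = 3 - 2 * sqrt 2 * cos (t * ln 2)"
    and "0 < t" and "t < pi / ln 2"
    and "finite {x \<in> E. F x \<noteq> 0}"
  shows "(\<forall>x0\<in>E. convergent (ball_average E x0 (P_tilde E lam t F) (P_tilde E lam t F)))
    \<and> (\<forall>x0\<in>E. \<forall>x1\<in>E. mean_inner E x0 (P_tilde E lam t F) (P_tilde E lam t F)
          = mean_inner E x1 (P_tilde E lam t F) (P_tilde E lam t F))
    \<and> (\<forall>x0\<in>E. edge_inner E (P_tilde E lam t F) F
          = 36 * of_real (inverse (b_fun lam))
              * mean_inner E x0 (P_tilde E lam t F) (P_tilde E lam t F))"
proof -
  interpret cubic_tree V E
    using assms(1,2) by unfold_locales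
  obtain q r a b :: complex where kernel:
    "\<forall>n. psi (1/2 + \<i> * of_real t) (int n) / of_real (3 * (6 - lam)) = a * q ^ n + b * r ^ n"
    and qr: "q * r = 1/2" "q \<noteq> r" "norm q = 1 / sqrt 2" "norm r = 1 / sqrt 2"
    and cnj: "cnj q = r" "cnj a = b"
    and eigen: "radial_eigenfunction (1 + 2 * (q + r)) (\<lambda>n. a * q ^ n + b * r ^ n)"
    and ab: "a + b = 2/9" "648 * (a * b) = of_real (b_fun lam)" "b_fun lam \<noteq> 0"
    by (rule spectral_kernel[OF assms(4-6)])
  define \<kappa> where "\<kappa> n = a * q ^ n + b * r ^ n" for n
  have cnj_\<kappa>: "cnj (\<kappa> n) = \<kappa> n" for n
  proof -
    have "cnj r = q" "cnj b = a"
      using cnj complex_cnj_cnj by metis+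
    then show ?thesis
      by (simp add: \<kappa>_def cnj)
  qed
  have decay: "norm (\<kappa> n) \<le> (norm a + norm b) * (1 / sqrt 2) ^ n" for n
    using norm_triangle_ineq[of "a * q ^ n" "b * r ^ n"] qr(3,4)
    by (simp add: \<kappa>_def norm_mult norm_power distrib_right)
  have \<kappa>0: "\<kappa> 0 = 2/9"
    using ab(1) by (simp add: \<kappa>_def)
  define Y where "Y = {x\<in>E. F x \<noteq> 0}"
  have Y: "finite Y" "Y \<subseteq> E"
    using assms(7) by (auto simp: Y_def)
  define PF where "PF = P_tilde E lam t F"
  have PF: "PF x = (\<Sum>y\<in>Y. \<kappa> (edge_dist E x y) * F y)" for x
  proof -
    have "(\<Sum>\<^sub>\<infinity>y\<in>E. psi (1/2 + \<i> * of_real t) (int (edge_dist E x y)) * F y)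
        = (\<Sum>\<^sub>\<infinity>y\<in>Y. psi (1/2 + \<i> * of_real t) (int (edge_dist E x y)) * F y)"
      by (rule infsum_cong_neutral) (auto simp: Y_def)
    then have "PF x = (\<Sum>y\<in>Y. psi (1/2 + \<i> * of_real t) (int (edge_dist E x y)) / of_real (3 * (6 - lam)) * F y)"
      using Y(1) by (simp add: PF_def P_tilde_def sum_divide_distrib)
    then show ?thesis
      by (simp only: kernel \<kappa>_def)
  qed
  \<comment> \<open>The common value of both sides, up to the constant.\<close>
  define S where "S = (\<Sum>y\<in>Y. \<Sum>y'\<in>Y. F y * cnj (F y') * \<kappa> (edge_dist E y' y))"
  have inner: "edge_inner E PF F = S"
  proof -
    have "edge_inner E PF F = (\<Sum>\<^sub>\<infinity>x\<in>Y. PF x * cnj (F x))"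
      unfolding edge_inner_def by (rule infsum_cong_neutral) (auto simp: Y_def)
    also have "\<dots> = (\<Sum>y'\<in>Y. \<Sum>y\<in>Y. F y * cnj (F y') * \<kappa> (edge_dist E y' y))"
      using Y(1) by (simp add: PF sum_distrib_left sum_distrib_right mult_ac)
    also have "\<dots> = S"
      unfolding S_def by (rule sum.swap)
    finally show ?thesis .
  qed
  have mean: "ball_average E x0 PF PF \<longlonglongrightarrow> of_real (b_fun lam) / 36 * S" if x0: "x0 \<in> E" for x0
  proof -
    define B where "B N = {x\<in>E. edge_dist E x x0 \<le> N}" for N
    have const: "of_real (b_fun lam) / 36 = 4 * a * b / \<kappa> 0"
      unfolding ab(2)[symmetric] \<kappa>0 by simp
    have pair: "(\<lambda>N. 1 / of_nat N * (\<Sum>x\<in>B N. \<kappa> (edge_dist E x y) * \<kappa> (edge_dist E x y')))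
        \<longlonglongrightarrow> of_real (b_fun lam) / 36 * \<kappa> (edge_dist E y' y)" if "y \<in> Y" "y' \<in> Y" for y y'
      unfolding const B_def using that Y(2) \<kappa>0
      by (intro pair_mean[OF eigen[folded \<kappa>_def] x0 _ _ _ decay
            sphere_weighted_mean[OF qr, of a b, folded \<kappa>_def]]) auto
    have expand: "ball_average E x0 PF PF N = (\<Sum>y\<in>Y. \<Sum>y'\<in>Y. F y * cnj (F y') *
        (1 / of_nat N * (\<Sum>x\<in>B N. \<kappa> (edge_dist E x y) * \<kappa> (edge_dist E x y'))))" for N
    proof -
      have "PF x * cnj (PF x) = (\<Sum>y\<in>Y. \<Sum>y'\<in>Y. F y * cnj (F y') *
          (\<kappa> (edge_dist E x y) * \<kappa> (edge_dist E x y')))" for x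
        unfolding PF cnj_sum sum_product by (intro sum.cong refl) (simp add: cnj_\<kappa> mult_ac)
      then have "(\<Sum>x\<in>B N. PF x * cnj (PF x)) = (\<Sum>x\<in>B N. \<Sum>y\<in>Y. \<Sum>y'\<in>Y. F y * cnj (F y') *
          (\<kappa> (edge_dist E x y) * \<kappa> (edge_dist E x y')))"
        by simp
      also have "\<dots> = (\<Sum>y\<in>Y. \<Sum>x\<in>B N. \<Sum>y'\<in>Y. F y * cnj (F y') *
          (\<kappa> (edge_dist E x y) * \<kappa> (edge_dist E x y')))"
        by (rule sum.swap)
      also have "\<dots> = (\<Sum>y\<in>Y. \<Sum>y'\<in>Y. \<Sum>x\<in>B N. F y * cnj (F y') *
          (\<kappa> (edge_dist E x y) * \<kappa> (edge_dist E x y')))"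
        by (rule sum.cong[OF refl sum.swap])
      finally show ?thesis
        unfolding ball_average_def B_def by (simp add: sum_distrib_left mult_ac)
    qed
    have "(\<lambda>N. \<Sum>y\<in>Y. \<Sum>y'\<in>Y. F y * cnj (F y') *
        (1 / of_nat N * (\<Sum>x\<in>B N. \<kappa> (edge_dist E x y) * \<kappa> (edge_dist E x y'))))
      \<longlonglongrightarrow> (\<Sum>y\<in>Y. \<Sum>y'\<in>Y. F y * cnj (F y') * (of_real (b_fun lam) / 36 * \<kappa> (edge_dist E y' y)))"
      by (intro tendsto_sum tendsto_mult_left pair)
    moreover have "(\<Sum>y\<in>Y. \<Sum>y'\<in>Y. F y * cnj (F y') * (of_real (b_fun lam) / 36 * \<kappa> (edge_dist E y' y)))
        = of_real (b_fun lam) / 36 * S"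
      unfolding S_def sum_distrib_left by (intro sum.cong refl) (simp only: mult_ac)
    ultimately show ?thesis
      unfolding expand[abs_def] by (simp only:)
  qed
  then have mean_eq: "mean_inner E x0 PF PF = of_real (b_fun lam) / 36 * S" if "x0 \<in> E" for x0
    unfolding mean_inner_def using that by (intro limI)
  have "convergent (ball_average E x0 PF PF)" if "x0 \<in> E" for x0
    using mean[OF that] by (rule convergentI)
  moreover have "36 * of_real (inverse (b_fun lam)) * (of_real (b_fun lam) / 36 * S) = S"
    using ab(3) by simp
  ultimately show ?thesis
    unfolding PF_def[symmetric] inner by (intro conjI ballI) (simp_all only: mean_eq)
qed

end
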